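(* Let $(G,\chi)$ be a colored graph with vertex cover number $r$. Then $\mathrm{WLD}_1(G,\chi)\le \frac{2}{3}r+1$.
   Context: Graphs are finite, simple, undirected with non-empty vertex set; a colored graph $(G,\chi)$ has a vertex coloring $\chi\colon V(G)\to C$; $\mathrm{im}(\chi)$ is its set of colors. The vertex cover number is the minimum size of a set of vertices meeting every edge. For $k\ge1$, $\mathrm{WL}_k(G,\chi)$ denotes the stable coloring of $V(G)^k$ computed by the $k$-dimensional Weisfeiler--Leman algorithm (for $k=1$: color refinement, where a vertex's new color is its old color together with the multiset of its neighbors' old colors; for $k\ge2$: tuples initially colored by the isomorphism type of the induced ordered colored subgraph, and refined by the multiset over $w$ of the tuples of colors of $\bar v[w/1],\dots,\bar v[w/k]$). For a vertex $v$, $\mathrm{WL}_k(G,\chi)(v)$ means the color of $(v,\dots,v)$. For $u\in V(G)$, $\chi[u]$ is obtained from $\chi$ by giving $u$ a new unique color. A flip function for $(G,\chi)$ is a symmetric map $f\colon\mathrm{im}(\chi)^2\to\{0,1\}$; the $f$-flip $\mathrm{flip}_f(G,\chi)=(G',\chi)$ has $V(G')=V(G)$ and, for distinct $v,w$, $vw\in E(G')$ iff ($vw\in E(G)$ xor $f(\chi(v),\chi(w))=1$). A $k$-IRC tree of $(G,\chi)$ is a rooted tree $(T,r)$ with a map $\gamma$ assigning each node $t$ a colored graph $(G_t,\chi_t)$, with $\gamma(r)=(G,\chi)$, every leaf $t$ has $|V(G_t)|=1$, and each internal node $t$ satisfies at least one of: (D1) $t$ has one child $s$, $G_s=G_t$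 and $\chi_s(v)=\mathrm{WL}_k(G_t,\chi_t)(v)$ for all $v$; (D2) $t$ has one child $s$ with $(G_s,\chi_s)=\mathrm{flip}_f(G_t,\chi_t)$ for some flip function $f$; (D3) $G_t$ has connected components with vertex sets $A_1,\dots,A_\ell$ and $t$ has exactly $\ell$ children $s_i$ with $(G_{s_i},\chi_{s_i})=(G_t[A_i],\chi_t|_{A_i})$; (D4) $t$ has one child $s$ with $G_s=G_t$, $\chi_s=\chi_t[u]$ for some $u\in V(G_t)$. An individualization node is one satisfying (D4) but none of (D1)–(D3). The individualization depth of the tree is the maximum number of individualization nodes on a root-to-leaf path, and the $k$-WL depth $\mathrm{WLD}_k(G,\chi)$ is the minimum individualization depth over all $k$-IRC trees of $(G,\chi)$. *)

theory Defs
  imports Complex_Main "HOL-Library.Multiset"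
begin

record 'v graph =
  verts :: "'v set"
  edges :: "'v set set"

definition simple_graph :: "'v graph \<Rightarrow> bool" where
  "simple_graph G \<longleftrightarrow> finite (verts G) \<and> verts G \<noteq> {} \<and>
     (\<forall>e\<in>edges G. e \<subseteq> verts G \<and> card e = 2)"

definition adj :: "'v graph \<Rightarrow> 'v \<Rightarrow> 'v \<Rightarrow> bool" where
  "adj G v w \<longleftrightarrow> {v, w} \<in> edges G"

definition vertex_cover :: "'v graph \<Rightarrow> 'v set \<Rightarrow> bool" where
  "vertex_cover G S \<longleftrightarrow> S \<subseteq> verts G \<and> (\<forall>e\<in>edges G. e \<inter> S \<noteq> {})"

definition vertex_cover_number :: "'v graph \<Rightarrow> nat" where
  "vertex_cover_number G = (LEAST n. \<exists>S. vertex_cover G S \<and> card S = n)"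

definition induced :: "'v graph \<Rightarrow> 'v set \<Rightarrow> 'v graph" where
  "induced G A = \<lparr>verts = A, edges = {e \<in> edges G. e \<subseteq> A}\<rparr>"

definition components :: "'v graph \<Rightarrow> 'v set set" where
  "components G =
     verts G // {(u, v). u \<in> verts G \<and> v \<in> verts G \<and> (adj G)\<^sup>*\<^sup>* u v}"

text \<open>A universe of colors that is closed under the color constructions of the
  Weisfeiler--Leman algorithms, so that the colorings occurring at all nodes of a tree
  have the same type. An arbitrary coloring with colors in \<open>'c\<close> embeds via \<open>Base\<close>.
  \<open>Atomic\<close> holds the isomorphism type of an ordered colored graph given by a tuple:
  the colors of the entries, the pairs of positions with equal entries, and the pairs
  of positions with adjacent entries. The type is infinite, so new colors always exist.\<close>

datatype 'c color =
    Base 'c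
  | CR "'c color" "'c color multiset"
  | Atomic "'c color list" "(nat \<times> nat) set" "(nat \<times> nat) set"
  | WLC "'c color" "'c color list multiset"

type_synonym ('v, 'c) cgraph = "'v graph \<times> ('v \<Rightarrow> 'c color)"

definition stable_coloring ::
  "'x set \<Rightarrow> (('x \<Rightarrow> 'c) \<Rightarrow> 'x \<Rightarrow> 'c) \<Rightarrow> ('x \<Rightarrow> 'c) \<Rightarrow> 'x \<Rightarrow> 'c" where
  "stable_coloring X step c =
     (step ^^ (LEAST n. \<forall>x\<in>X. \<forall>y\<in>X.
        (step ^^ n) c x = (step ^^ n) c y \<longleftrightarrow>
        (step ^^ Suc n) c x = (step ^^ Suc n) c y)) c"

definition cr_step :: "'v graph \<Rightarrow> ('v \<Rightarrow> 'c color) \<Rightarrow> 'v \<Rightarrow> 'c color" where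
  "cr_step G c v = CR (c v) (image_mset c (mset_set {w \<in> verts G. adj G v w}))"

definition atomic_type :: "'v graph \<Rightarrow> ('v \<Rightarrow> 'c color) \<Rightarrow> 'v list \<Rightarrow> 'c color" where
  "atomic_type G \<chi> vs = Atomic (map \<chi> vs)
     {(i, j). i < length vs \<and> j < length vs \<and> vs ! i = vs ! j}
     {(i, j). i < length vs \<and> j < length vs \<and> adj G (vs ! i) (vs ! j)}"

definition wl_step ::
  "'v graph \<Rightarrow> nat \<Rightarrow> ('v list \<Rightarrow> 'c color) \<Rightarrow> 'v list \<Rightarrow> 'c color" where
  "wl_step G k c vs = WLC (c vs)
     (image_mset (\<lambda>w. map (\<lambda>i. c (vs[i := w])) [0..<k]) (mset_set (verts G)))"

definition tuples :: "'v graph \<Rightarrow> nat \<Rightarrow> 'v list set" where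
  "tuples G k = {vs. length vs = k \<and> set vs \<subseteq> verts G}"

text \<open>The color of the constant tuple \<open>(v, \<dots>, v)\<close> under the stable coloring; meaningful
  for \<open>k \<ge> 1\<close>.\<close>

definition WL :: "nat \<Rightarrow> 'v graph \<Rightarrow> ('v \<Rightarrow> 'c color) \<Rightarrow> 'v \<Rightarrow> 'c color" where
  "WL k G \<chi> v =
     (if k = 1 then stable_coloring (verts G) (cr_step G) \<chi> v
      else stable_coloring (tuples G k) (wl_step G k) (atomic_type G \<chi>) (replicate k v))"

definition flip_function :: "('v, 'c) cgraph \<Rightarrow> ('c color \<Rightarrow> 'c color \<Rightarrow> bool) \<Rightarrow> bool" where
  "flip_function = (\<lambda>(G, \<chi>) f.
     \<forall>a \<in> \<chi> ` verts G. \<forall>b \<in> \<chi> ` verts G. f a b = f b a)"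

definition flip :: "('c color \<Rightarrow> 'c color \<Rightarrow> bool) \<Rightarrow> ('v, 'c) cgraph \<Rightarrow> ('v, 'c) cgraph" where
  "flip f = (\<lambda>(G, \<chi>).
     (\<lparr>verts = verts G,
       edges = {{v, w} |v w. v \<in> verts G \<and> w \<in> verts G \<and> v \<noteq> w \<and>
                  adj G v w \<noteq> f (\<chi> v) (\<chi> w)}\<rparr>, \<chi>))"

text \<open>Colorings are total functions, only their values on the vertices count.\<close>

definition cg_eq :: "('v, 'c) cgraph \<Rightarrow> ('v, 'c) cgraph \<Rightarrow> bool" (infix "\<cong>\<^sub>c" 50) where
  "cg_eq = (\<lambda>(G, \<chi>) (H, \<psi>). G = H \<and> (\<forall>v\<in>verts G. \<chi> v = \<psi> v))"

datatype 'a rtree = Node (label: 'a) (children: "'a rtree list")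

type_synonym ('v, 'c) gtree = "('v, 'c) cgraph rtree"

definition D1 :: "nat \<Rightarrow> ('v, 'c) gtree \<Rightarrow> bool" where
  "D1 k t \<longleftrightarrow> (\<exists>G \<chi> s. label t = (G, \<chi>) \<and> children t = [s] \<and>
     label s \<cong>\<^sub>c (G, WL k G \<chi>))"

definition D2 :: "('v, 'c) gtree \<Rightarrow> bool" where
  "D2 t \<longleftrightarrow> (\<exists>s f. children t = [s] \<and> flip_function (label t) f \<and>
     label s \<cong>\<^sub>c flip f (label t))"

definition D3 :: "('v, 'c) gtree \<Rightarrow> bool" where
  "D3 t \<longleftrightarrow> (\<exists>G \<chi> As. label t = (G, \<chi>) \<and> distinct As \<and> set As = components G \<and>
     list_all2 (\<lambda>s A. label s \<cong>\<^sub>c (induced G A, \<chi>)) (children t) As)"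

definition D4 :: "('v, 'c) gtree \<Rightarrow> bool" where
  "D4 t \<longleftrightarrow> (\<exists>G \<chi> s u c. label t = (G, \<chi>) \<and> children t = [s] \<and>
     u \<in> verts G \<and> c \<notin> \<chi> ` verts G \<and> label s \<cong>\<^sub>c (G, \<chi>(u := c)))"

primrec subtrees :: "'a rtree \<Rightarrow> 'a rtree set" where
  "subtrees (Node a ts) = insert (Node a ts) (\<Union> (set (map subtrees ts)))"

text \<open>Nodes of a tree are represented by the subtrees rooted at them.\<close>

definition irc_tree :: "nat \<Rightarrow> ('v, 'c) cgraph \<Rightarrow> ('v, 'c) gtree \<Rightarrow> bool" where
  "irc_tree k g T \<longleftrightarrow> label T = g \<and>
     (\<forall>t\<in>subtrees T. if children t = [] then card (verts (fst (label t))) = 1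
                     else D1 k t \<or> D2 t \<or> D3 t \<or> D4 t)"

definition indiv_node :: "nat \<Rightarrow> ('v, 'c) gtree \<Rightarrow> bool" where
  "indiv_node k t \<longleftrightarrow> D4 t \<and> \<not> D1 k t \<and> \<not> D2 t \<and> \<not> D3 t"

primrec root_leaf_paths :: "'a rtree \<Rightarrow> 'a rtree list set" where
  "root_leaf_paths (Node a ts) =
     (if ts = [] then {[Node a ts]}
      else (#) (Node a ts) ` \<Union> (set (map root_leaf_paths ts)))"

definition indiv_depth :: "nat \<Rightarrow> ('v, 'c) gtree \<Rightarrow> nat" where
  "indiv_depth k T =
     Max ((\<lambda>p. length (filter (indiv_node k) p)) ` root_leaf_paths T)"

definition WLD :: "nat \<Rightarrow> ('v, 'c) cgraph \<Rightarrow> nat" where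
  "WLD k g = (LEAST d. \<exists>T. irc_tree k g T \<and> indiv_depth k T = d)"

end

theory Submission
  imports Defs
begin

text \<open>
  Fix a vertex cover \<open>S\<close> and let the potential of a stable coloring be
  \<open>2 (|S| - number of colors on S)\<close>, plus \<open>3\<close> if some color occurs both inside and outside
  of \<open>S\<close> (the coloring is not pure). It suffices to make every individualization lower the
  potential by \<open>3\<close> on average. Without individualizing one can pass to connected components and
  flip pairs of color classes as long as this removes edges and \<open>S\<close> remains a cover; in
  particular no two classes are then completely joined. Hence individualizing \<open>x\<close> splits every
  class adjacent to \<open>x\<close>. Suppose that no single vertex yields two new colors on \<open>S\<close>.

  If the coloring is pure, then \<open>S\<close> is independent and consists of a single class, and each vertex
  outside of \<open>S\<close> has at most \<open>|S|/2\<close> neighbours. By connectedness there are two such vertices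
  whose neighbourhoods cross; individualizing both cuts \<open>S\<close> into four classes.

  If the coloring is not pure, then edges inside \<open>S\<close> occur only in one degenerate form, between a
  mixed class with two vertices and a class \<open>{w, w'} \<subseteq> S\<close>. Individualizing \<open>w\<close> (or any vertex if
  there are no such edges) makes the coloring pure, because along an edge that is not inside
  \<open>S\<close>, belonging to a class inside or outside of \<open>S\<close> propagates.
\<close>

section \<open>Equitable colorings and vertex covers\<close>

definition equitable :: "'v set \<Rightarrow> ('v \<Rightarrow> 'v \<Rightarrow> bool) \<Rightarrow> ('v \<Rightarrow> 'k) \<Rightarrow> bool" where
  "equitable V E c \<longleftrightarrow> (\<forall>x\<in>V. \<forall>y\<in>V. c x = c y \<longrightarrow>
     (\<forall>k. card {z \<in> V. E x z \<and> c z = k} = card {z \<in> V. E y z \<and> c z = k}))"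

definition refines :: "'v set \<Rightarrow> ('v \<Rightarrow> 'k) \<Rightarrow> ('v \<Rightarrow> 'k) \<Rightarrow> bool" where
  "refines V c' c \<longleftrightarrow> (\<forall>x\<in>V. \<forall>y\<in>V. c' x = c' y \<longrightarrow> c x = c y)"

definition pure :: "'v set \<Rightarrow> 'v set \<Rightarrow> ('v \<Rightarrow> 'k) \<Rightarrow> bool" where
  "pure V S c \<longleftrightarrow> (\<forall>x\<in>S. \<forall>y\<in>V - S. c x \<noteq> c y)"

text \<open>Two further colors on \<open>S\<close> lower it by at least 4 and becoming pure lowers
  it by at least 3, so either kind of progress pays the price 3 of one individualization.\<close>

definition potential :: "'v set \<Rightarrow> 'v set \<Rightarrow> ('v \<Rightarrow> 'k) \<Rightarrow> nat" where
  "potential V S c = 2 * (card S - card (c ` S)) + (if pure V S c then 0 else 3)"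

text \<open>Records only those properties of "individualize \<open>x\<close>, then refine" that the
  analysis uses, so that the combinatorial part is independent of the color type and of the
  refinement procedure.\<close>

definition individualizes ::
  "'v set \<Rightarrow> ('v \<Rightarrow> 'v \<Rightarrow> bool) \<Rightarrow> 'v \<Rightarrow> ('v \<Rightarrow> 'k) \<Rightarrow> ('v \<Rightarrow> 'k) \<Rightarrow> bool" where
  "individualizes V E x c c' \<longleftrightarrow>
     refines V c' c \<and> equitable V E c' \<and> (\<forall>y\<in>V. c' y = c' x \<longrightarrow> y = x)"

lemma equitable_transfer:
  assumes "finite V" "equitable V E c" "x \<in> V" "x' \<in> V" "c x' = c x" "E x y" "y \<in> V"
  shows "\<exists>y'\<in>V. E x' y' \<and> c y' = c y"
proof -
  have "card {z \<in> V. E x' z \<and> c z = c y} = card {z \<in> V. E x z \<and> c z = c y}"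
    using assms unfolding equitable_def by blast
  moreover have "card {z \<in> V. E x z \<and> c z = c y} > 0"
    using assms by (auto simp: card_gt_0_iff)
  ultimately show ?thesis
    by (metis (mono_tags, lifting) card_gt_0_iff empty_Collect_eq)
qed

text \<open>With equal colors, \<open>z\<close> would also have a neighbour of the color of
  \<open>x\<close>, and \<open>x\<close> is the only vertex of that color.\<close>

lemma equitable_separates:
  assumes "finite V" "equitable V E c" "\<forall>y\<in>V. c y = c x \<longrightarrow> y = x"
    and "x \<in> V" "y \<in> V" "z \<in> V" "E y x" "\<not> E z x"
  shows "c y \<noteq> c z"
  using equitable_transfer[of V E c y z x] assms by metis

text \<open>The colors of \<open>c\<close> on \<open>S\<close> that do not occur on \<open>A\<close>
  are carried by \<open>B\<close>; the colors of \<open>c'\<close> on \<open>B\<close> are at least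
  as many and differ from those on \<open>A\<close>. So colors gained on a small set
  \<open>A\<close> of witnesses are gained on all of \<open>S\<close>.\<close>

lemma refines_card_image:
  assumes "refines V c' c" "S \<subseteq> V" "finite S" "A \<subseteq> S"
  shows "card (c ` S) + card (c' ` A) \<le> card (c' ` S) + card (c ` A)"
proof -
  define B where "B = {s \<in> S. c s \<notin> c ` A}"
  have "c a \<noteq> c b" if "a \<in> A" "b \<in> B" for a b
    using that unfolding B_def by (metis (no_types, lifting) imageI mem_Collect_eq)
  then have B: "c ` S = c ` A \<union> c ` B" "c ` A \<inter> c ` B = {}" "B \<subseteq> S"
    using assms(4) unfolding B_def by blast+
  have fin: "finite A" "finite B" using assms B(3) finite_subset by blast+
  have r: "c x = c y" if "x \<in> S" "y \<in> S" "c' x = c' y" for x y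
    using assms(1,2) that unfolding refines_def by blast
  \<comment> \<open>Recovers the color under \<open>c\<close> from the color under
    \<open>c'\<close>; the choice of the preimage does not matter because \<open>c'\<close> refines
    \<open>c\<close>.\<close>
  define g where "g = (\<lambda>k. c (SOME x. x \<in> S \<and> c' x = k))"
  have "g (c' x) = c x" if "x \<in> S" for x
    using someI[of "\<lambda>y. y \<in> S \<and> c' y = c' x" x] r[of _ x] that unfolding g_def by blast
  then have "c ` B = g ` c' ` B" using B(3) unfolding image_image by (intro image_cong) auto
  then have 1: "card (c ` B) \<le> card (c' ` B)" using fin by (simp add: card_image_le)
  have "c' ` A \<inter> c' ` B = {}"
  proof -
    have "c' a \<noteq> c' b" if "a \<in> A" "b \<in> B" for a b
      using r[of a b] that assms(4) B(2,3) by blast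
    then show ?thesis by blast
  qed
  then have "card (c' ` A) + card (c' ` B) = card (c' ` A \<union> c' ` B)"
    using fin by (intro card_Un_disjoint[symmetric]) auto
  also have "\<dots> \<le> card (c' ` S)"
    using assms(3,4) B(3) by (intro card_mono) auto
  finally show ?thesis
    using 1 B(1) card_Un_disjoint[OF _ _ B(2)] fin by simp
qed

lemma refines_trans: "refines V c'' c' \<Longrightarrow> refines V c' c \<Longrightarrow> refines V c'' c"
  unfolding refines_def by blast

lemma pure_refines: "pure V S c \<Longrightarrow> refines V c' c \<Longrightarrow> S \<subseteq> V \<Longrightarrow> pure V S c'"
  unfolding pure_def refines_def by blast

lemma potential_gain:
  assumes "refines V c' c" "S \<subseteq> V" "finite S" "card (c ` S) + n \<le> card (c' ` S)"
  shows "potential V S c' + 2 * n \<le> potential V S c"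
proof -
  have "card (c' ` S) \<le> card S" using assms by (intro card_image_le)
  then show ?thesis
    using assms pure_refines[of V S c c'] unfolding potential_def by auto
qed

text \<open>The state in which no free step makes progress. \<open>not_full\<close> excludes a
  clique class with an edge, and \<open>not_dense\<close> a pair of classes of density above one
  half whose second class lies in \<open>S\<close>: flipping either would remove edges and keep
  \<open>S\<close> a cover. Connectedness is phrased as an edge leaving each proper vertex set,
  which suits closure arguments.\<close>

locale reduced_coloring =
  fixes V :: "'v set" and E :: "'v \<Rightarrow> 'v \<Rightarrow> bool" and c :: "'v \<Rightarrow> 'k" and S :: "'v set"
  assumes finite_V: "finite V"
    and E_in: "E x y \<Longrightarrow> x \<in> V \<and> y \<in> V"
    and E_sym: "E x y \<Longrightarrow> E y x"
    and E_irrefl: "\<not> E x x"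
    and S_V: "S \<subseteq> V"
    and cover: "E x y \<Longrightarrow> x \<in> S \<or> y \<in> S"
    and equitable: "equitable V E c"
    and connected: "Z \<subseteq> V \<Longrightarrow> Z \<noteq> {} \<Longrightarrow> Z \<noteq> V \<Longrightarrow> \<exists>p\<in>Z. \<exists>q\<in>V - Z. E p q"
    and not_full: "E x y \<Longrightarrow> c x = c y \<Longrightarrow> \<exists>z\<in>V. c z = c y \<and> z \<noteq> x \<and> \<not> E x z"
    and not_dense: "E x y \<Longrightarrow> c x \<noteq> c y \<Longrightarrow> \<forall>z\<in>V. c z = c y \<longrightarrow> z \<in> S \<Longrightarrow>
      2 * card {z \<in> V. E x z \<and> c z = c y} \<le> card {z \<in> V. c z = c y}"
    and two_vertices: "\<exists>x\<in>V. \<exists>y\<in>V. x \<noteq> y"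
begin

abbreviation "single c' x \<equiv> \<forall>y\<in>V. c' y = c' x \<longrightarrow> y = x"

lemma finite_S: "finite S"
  using finite_V S_V finite_subset by blast

lemma transfer: "E x y \<Longrightarrow> x' \<in> V \<Longrightarrow> c x' = c x \<Longrightarrow> \<exists>y'\<in>V. E x' y' \<and> c y' = c y"
  using equitable_transfer[OF finite_V equitable] E_in by blast

lemma degree_eq:
  "x \<in> V \<Longrightarrow> y \<in> V \<Longrightarrow> c x = c y \<Longrightarrow>
    card {z \<in> V. E x z \<and> c z = k} = card {z \<in> V. E y z \<and> c z = k}"
  using equitable unfolding equitable_def by blast

text \<open>Within one class this is \<open>not_full\<close>. For two classes, a vertex joined to
  the whole other class would by equitability join the two classes completely; then one of them lies
  in \<open>S\<close>, and full density contradicts \<open>not_dense\<close> towards that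
  class.\<close>

lemma nontrivial:
  assumes "E x y"
  shows "\<exists>z\<in>V. c z = c y \<and> z \<noteq> x \<and> \<not> E x z"
proof (rule ccontr)
  assume n: "\<not> ?thesis"
  then have d: "c x \<noteq> c y" using not_full[OF assms] by blast
  have xy: "x \<in> V" "y \<in> V" using E_in assms by auto
  have full: "E x z" if "z \<in> V" "c z = c y" for z
  proof -
    have "z \<noteq> x" using that d by auto
    then show ?thesis using n that by blast
  qed
  have full': "E u z" if "u \<in> V" "c u = c x" "z \<in> V" "c z = c y" for u z
  proof -
    have "card {z \<in> V. E u z \<and> c z = c y} = card {z \<in> V. c z = c y}"
    proof -
      have "{z \<in> V. E x z \<and> c z = c y} = {z \<in> V. c z = c y}" using full by blast
      then show ?thesis using degree_eq[of u x "c y"] that xy by simp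
    qed
    then have "{z \<in> V. E u z \<and> c z = c y} = {z \<in> V. c z = c y}"
      using finite_V by (intro card_subset_eq) auto
    then show ?thesis using that by blast
  qed
  show False
  proof (cases "\<forall>z\<in>V. c z = c y \<longrightarrow> z \<in> S")
    case True
    have "{z \<in> V. E x z \<and> c z = c y} = {z \<in> V. c z = c y}" using full by blast
    moreover have "card {z \<in> V. c z = c y} > 0" using finite_V xy by (auto simp: card_gt_0_iff)
    ultimately show False using not_dense[OF assms d True] by simp
  next
    case False
    then have *: "\<forall>z\<in>V. c z = c x \<longrightarrow> z \<in> S" using full' cover by blast
    have "{z \<in> V. E y z \<and> c z = c x} = {z \<in> V. c z = c x}" using full' xy E_sym by blast
    moreover have "card {z \<in> V. c z = c x} > 0" using finite_V xy by (auto simp: card_gt_0_iff)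
    ultimately show False using not_dense[OF E_sym[OF assms] _ *] d by simp
  qed
qed

lemma separates:
  assumes "equitable V E c'" "single c' x" "E x y" "\<not> E x z" "z \<in> V"
  shows "c' y \<noteq> c' z"
  using equitable_separates[OF finite_V assms(1,2), of y z] assms E_in E_sym by blast

lemma gain_three:
  assumes "refines V c' c" "a \<in> S" "b \<in> S" "d \<in> S" "c a = c b" "c b = c d"
    and "c' a \<noteq> c' b" "c' a \<noteq> c' d" "c' b \<noteq> c' d"
  shows "card (c ` S) + 2 \<le> card (c' ` S)"
  using refines_card_image[OF assms(1) S_V finite_S, of "{a, b, d}"] assms by simp

lemma gain_pairs:
  assumes "refines V c' c" "a \<in> S" "b \<in> S" "d \<in> S" "e \<in> S" "c a = c b" "c d = c e" "c a \<noteq> c d"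
    and "c' a \<noteq> c' b" "c' d \<noteq> c' e"
  shows "card (c ` S) + 2 \<le> card (c' ` S)"
proof -
  have r: "c x = c y" if "x \<in> S" "y \<in> S" "c' x = c' y" for x y
    using assms(1) that S_V unfolding refines_def by blast
  have "c' a \<noteq> c' d" "c' a \<noteq> c' e" "c' b \<noteq> c' d" "c' b \<noteq> c' e"
    using r assms by metis+
  then show ?thesis
    using refines_card_image[OF assms(1) S_V finite_S, of "{a, b, d, e}"] assms by simp
qed

end

text \<open>No single vertex guarantees progress: each has an outcome with at most one new color on
  \<open>S\<close> and without a change from impure to pure. Configurations are refuted by naming a
  vertex all of whose outcomes bring two new colors.\<close>

locale stuck_coloring = reduced_coloring V E c S
  for V :: "'v set" and E :: "'v \<Rightarrow> 'v \<Rightarrow> bool" and c :: "'v \<Rightarrow> 'k" and S :: "'v set" +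
  assumes stuck: "x \<in> V \<Longrightarrow> \<exists>c'. individualizes V E x c c' \<and> card (c' ` S) < card (c ` S) + 2 \<and>
    (pure V S c \<or> \<not> pure V S c')"
begin

section \<open>Edges with both ends in the cover\<close>

lemma no_split:
  assumes "x \<in> V"
  obtains c' where "refines V c' c" "equitable V E c'" "single c' x"
    "card (c' ` S) < card (c ` S) + 2"
  using stuck[OF assms] unfolding individualizes_def by blast

text \<open>Every vertex that shares the color of \<open>a\<close> under \<open>c'\<close> is
  adjacent to the isolated vertex \<open>z\<close>, so \<open>uniq\<close> applies to it. Being
  alone in a class thus spreads along edges without another individualization.\<close>

lemma single_neighbour:
  assumes "refines V c' c" "equitable V E c'" "single c' z" "E a z"
    and uniq: "\<And>b. E b z \<Longrightarrow> c b = c a \<Longrightarrow> b = a"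
  shows "single c' a"
proof (intro ballI impI)
  fix b assume b: "b \<in> V" "c' b = c' a"
  have V: "a \<in> V" "z \<in> V" using E_in assms(4) by blast+
  have "c b = c a" using assms(1) b V unfolding refines_def by blast
  moreover have "E b z"
  proof (rule ccontr)
    assume "\<not> E b z"
    then have "\<not> E z b" using E_sym by blast
    then show False using separates[OF assms(2,3) E_sym[OF assms(4)] _ b(1)] b(2) by simp
  qed
  ultimately show "b = a" using uniq by blast
qed

text \<open>Individualizing \<open>v\<close> separates it from \<open>v'\<close>; a non-neighbour
  \<open>d\<close> would moreover be separated from \<open>w\<close>, which makes two new
  colors.\<close>

lemma fat_split:
  assumes "E v w" "v \<in> S" "w \<in> S" "c v \<noteq> c w" "v' \<in> S" "v' \<noteq> v" "c v' = c v"
    and "d \<in> S" "c d = c w"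
  shows "E v d"
proof (rule ccontr)
  assume n: "\<not> E v d"
  have V: "v \<in> V" "v' \<in> V" "d \<in> V" using assms S_V by blast+
  obtain c' where c': "refines V c' c" "equitable V E c'" "single c' v"
    "card (c' ` S) < card (c ` S) + 2"
    using V(1) by (rule no_split)
  have 1: "c' v' \<noteq> c' v" using c'(3) V assms(6) by blast
  have 2: "c' w \<noteq> c' d" using separates[OF c'(2,3) assms(1) n V(3)] .
  have "card (c ` S) + 2 \<le> card (c' ` S)"
    by (rule gain_pairs[OF c'(1) assms(5,2,3,8) _ _ _ 1 2]) (use assms in simp_all)
  then show False using c'(4) by linarith
qed

text \<open>By \<open>fat_split\<close> the parts of the two classes inside \<open>S\<close> are
  completely joined, so the non-neighbours given by \<open>nontrivial\<close> lie outside
  \<open>S\<close>. This unbalances the degrees between the classes.\<close>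

lemma no_fat_edge:
  assumes "E v w" "v \<in> S" "w \<in> S" "c v \<noteq> c w" "v' \<in> S" "v' \<noteq> v" "c v' = c v"
    and "w' \<in> S" "w' \<noteq> w" "c w' = c w"
  shows False
proof -
  have w: "E a w" if "a \<in> S" "c a = c v" for a
    using fat_split[OF E_sym[OF assms(1)] assms(3,2) _ assms(8,9,10) that] assms(4) E_sym by simp
  have all: "E a d" if a: "a \<in> S" "c a = c v" and d: "d \<in> S" "c d = c w" for a d
  proof (cases "a = v")
    case True
    show ?thesis using fat_split[OF assms(1-7) d] True by simp
  next
    case False
    show ?thesis
      by (rule fat_split[OF w[OF a] a(1) assms(3) _ assms(2) _ _ d]) (use False a assms(4) in simp_all)
  qed
  obtain z where z: "z \<in> V" "c z = c w" "\<not> E v z"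
    using nontrivial[OF assms(1)] by blast
  then have zS: "z \<notin> S" using all assms(2) by blast
  obtain y where y: "y \<in> V" "c y = c v" "\<not> E w y"
    using nontrivial[OF E_sym[OF assms(1)]] by blast
  then have yS: "y \<notin> S" using w E_sym by blast
  obtain a where a: "a \<in> V" "E z a" "c a = c v"
    using transfer[OF E_sym[OF assms(1)] z(1,2)] by blast
  then have aS: "a \<in> S" using cover zS by blast
  \<comment> \<open>Since \<open>y\<close> is outside \<open>S\<close>, its neighbours in the class
    of \<open>w\<close> lie in \<open>S\<close> and are also neighbours of \<open>a\<close>, which
    has the further neighbour \<open>z\<close>.\<close>
  have "{u \<in> V. E y u \<and> c u = c w} \<subseteq> {u \<in> V. E a u \<and> c u = c w}"
    using all[OF aS a(3)] cover[of y] yS by blast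
  moreover have "z \<notin> {u \<in> V. E y u \<and> c u = c w}" using cover[of y z] yS zS by blast
  moreover have "z \<in> {u \<in> V. E a u \<and> c u = c w}" using z E_sym[OF a(2)] by blast
  ultimately have "{u \<in> V. E y u \<and> c u = c w} \<subset> {u \<in> V. E a u \<and> c u = c w}" by blast
  then have "card {u \<in> V. E y u \<and> c u = c w} < card {u \<in> V. E a u \<and> c u = c w}"
    using finite_V by (intro psubset_card_mono) auto
  then show False using degree_eq[of y a "c w"] y a by simp
qed

text \<open>The part of the class inside \<open>S\<close> is a clique, as otherwise one
  individualization would cut three of its vertices apart. A vertex \<open>z\<close> outside
  \<open>S\<close> that misses \<open>v\<close> then has smaller degree into the class than its
  neighbour \<open>a\<close>.\<close>

lemma no_inner_edge:
  assumes "E v w" "v \<in> S" "w \<in> S" "c v = c w"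
  shows False
proof -
  have nbr: "E a d" if h: "E a b" "a \<in> S" "b \<in> S" "c a = c v" "c b = c v" "d \<in> S" "c d = c v" "d \<noteq> a"
    for a b d
  proof (rule ccontr)
    assume n: "\<not> E a d"
    have V: "a \<in> V" "b \<in> V" "d \<in> V" using h S_V by blast+
    obtain c' where c': "refines V c' c" "equitable V E c'" "single c' a"
      "card (c' ` S) < card (c ` S) + 2"
      using V(1) by (rule no_split)
    have 1: "c' b \<noteq> c' d" using separates[OF c'(2,3) h(1) n V(3)] .
    have "b \<noteq> a" using h(1) E_irrefl by blast
    then have 2: "c' b \<noteq> c' a" "c' d \<noteq> c' a" using c'(3) V h(8) by blast+
    have "card (c ` S) + 2 \<le> card (c' ` S)"
      by (rule gain_three[OF c'(1) h(3,6,2) _ _ 1 2]) (use h in simp_all)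
    then show False using c'(4) by linarith
  qed
  have v: "E v d" if "d \<in> S" "c d = c v" "d \<noteq> v" for d
    using nbr[OF assms(1-3) refl _ that] assms(4) by simp
  have clique: "E a d" if "a \<in> S" "c a = c v" "d \<in> S" "c d = c v" "d \<noteq> a" for a d
  proof (cases "a = v")
    case True
    then show ?thesis using v that by simp
  next
    case False
    show ?thesis
      using nbr[OF E_sym[OF v[OF that(1,2) False]] that(1) assms(2) that(2) refl that(3-5)] .
  qed
  obtain z where z: "z \<in> V" "c z = c v" "z \<noteq> v" "\<not> E v z"
    using nontrivial[OF assms(1)] assms(4) by auto
  then have zS: "z \<notin> S" using v by blast
  obtain a where a: "a \<in> V" "E z a" "c a = c v"
    using transfer[OF assms(1) z(1,2)] assms(4) by auto
  then have aS: "a \<in> S" using cover zS by blast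
  let ?C = "{u \<in> S. c u = c v}"
  have fin: "finite ?C" using finite_S by simp
  have "{u \<in> V. E z u \<and> c u = c v} \<subseteq> ?C - {v}"
    using zS cover[of z] z(4) E_sym[of z v] by blast
  then have "card {u \<in> V. E z u \<and> c u = c v} \<le> card (?C - {v})"
    using fin by (intro card_mono) auto
  also have "\<dots> < card ?C"
    using fin assms(2) by (intro card_Diff1_less) auto
  \<comment> \<open>All of \<open>?C\<close> except \<open>a\<close> itself is adjacent to
    \<open>a\<close>, and so is \<open>z\<close>; exchanging \<open>a\<close> for \<open>z\<close>
    keeps the cardinality.\<close>
  also have "\<dots> = card (insert z (?C - {a}))"
  proof -
    have "card (insert z (?C - {a})) = Suc (card (?C - {a}))" using fin zS by simp
    also have "\<dots> = card ?C" by (rule card_Suc_Diff1[OF fin]) (use aS a in simp)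
    finally show ?thesis by simp
  qed
  also have "\<dots> \<le> card {u \<in> V. E a u \<and> c u = c v}"
  proof (rule card_mono)
    show "insert z (?C - {a}) \<subseteq> {u \<in> V. E a u \<and> c u = c v}"
      using clique[OF aS a(3)] z(1,2) E_sym[OF a(2)] S_V by blast
  qed (use finite_V in simp)
  finally show False using degree_eq[of z a "c v"] z a by simp
qed

text \<open>All neighbours of \<open>y\<close> lie in \<open>S\<close>, where \<open>v\<close> is
  alone in its class. So every vertex in the class of \<open>y\<close> has degree 1 into the class
  of \<open>v\<close>.\<close>

lemma unique_neighbour:
  assumes y: "E v y" "y \<notin> S" and mono: "\<forall>s\<in>S. c s = c v \<longrightarrow> s = v"
    and e: "c e = c y" "E e a" "E e b" "c a = c v" "c b = c v"
  shows "a = b"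
proof -
  have V: "y \<in> V" "v \<in> V" "e \<in> V" "a \<in> V" "b \<in> V" using E_in y e by blast+
  have "u = v" if "E y u" "c u = c v" for u
    using mono that cover[of y u] y(2) by blast
  then have "{u \<in> V. E y u \<and> c u = c v} = {v}"
    using V E_sym[OF y(1)] by blast
  then have "card {u \<in> V. E e u \<and> c u = c v} = 1"
    using degree_eq[of e y "c v"] e(1) V by simp
  then obtain t where t: "{u \<in> V. E e u \<and> c u = c v} = {t}" by (rule card_1_singletonE)
  have "a \<in> {u \<in> V. E e u \<and> c u = c v}" "b \<in> {u \<in> V. E e u \<and> c u = c v}" using e V by blast+
  then show ?thesis unfolding t by simp
qed

text \<open>The degenerate form of an edge inside \<open>S\<close>: a mixed class {\<open>v\<close>,
  \<open>x\<close>} and a class {\<open>w\<close>, \<open>w'\<close>} inside \<open>S\<close>,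
  joined by the matching \<open>v w\<close>, \<open>x w'\<close>. The neighbour of \<open>v\<close>
  outside \<open>S\<close> from \<open>minimal\<close> is what bounds the class of
  \<open>v\<close>.\<close>

lemma mono_cover_edge:
  assumes vw: "E v w" "v \<in> S" "w \<in> S" and mono: "\<forall>s\<in>S. c s = c v \<longrightarrow> s = v"
    and minimal: "\<exists>y. E v y \<and> y \<notin> S"
  obtains x w' where "x \<in> V" "w' \<in> S" "x \<notin> S" "c x = c v" "c w' = c w" "w' \<noteq> w"
    "\<And>u. u \<in> V \<Longrightarrow> c u = c v \<Longrightarrow> u = v \<or> u = x"
    "\<And>u. u \<in> V \<Longrightarrow> c u = c w \<Longrightarrow> u = w \<or> u = w'"
    "E x w'" "\<not> E x w" "\<not> E v w'"
proof -
  have V: "v \<in> V" "w \<in> V" using E_in vw by blast+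
  have cvw: "c v \<noteq> c w" using mono vw E_irrefl by auto
  obtain x where x: "x \<in> V" "c x = c v" "\<not> E w x"
    using nontrivial[OF E_sym[OF vw(1)]] by blast
  have xv: "x \<noteq> v" using x E_sym[OF vw(1)] by blast
  then have xS: "x \<notin> S" using mono x by blast
  have nxw: "\<not> E x w" using x E_sym by blast
  have other: "\<exists>z\<in>S. E x z \<and> c z = c y" if "E v y" "x \<in> V" "c x = c v" "x \<notin> S" for x y
    using transfer[OF that(1-3)] cover that(4) by blast
  \<comment> \<open>A vertex \<open>u\<close> outside \<open>S\<close> would force degree at least 2
    from the class of \<open>v\<close> into the class of \<open>w\<close>. Individualizing a
    neighbour \<open>z\<close> of \<open>x\<close> then isolates \<open>x\<close> too, and
    \<open>x\<close> tells a second neighbour \<open>z'\<close> from \<open>w\<close>.\<close>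
  have pureD: "u \<in> S" if u: "u \<in> V" "c u = c w" for u
  proof (rule ccontr)
    assume uS: "u \<notin> S"
    obtain a where a: "E u a" "c a = c v" using transfer[OF E_sym[OF vw(1)] u] by blast
    then have "a \<in> S" using cover uS by blast
    then have vu: "E v u" using mono a(2) E_sym[OF a(1)] by blast
    have "{w, u} \<subseteq> {z \<in> V. E v z \<and> c z = c w}" using vu vw(1) V u by blast
    then have "card {w, u} \<le> card {z \<in> V. E v z \<and> c z = c w}"
      using finite_V by (intro card_mono) auto
    moreover have "w \<noteq> u" using vw uS by blast
    ultimately have "2 \<le> card {z \<in> V. E x z \<and> c z = c w}"
      using degree_eq[of v x "c w"] x V by simp
    then obtain T where T: "T \<subseteq> {z \<in> V. E x z \<and> c z = c w}" "card T = 2"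
      by (elim obtain_subset_with_card_n)
    then obtain z z' where "T = {z, z'}" "z \<noteq> z'" by (meson card_2_iff)
    then have z: "z \<noteq> z'" "E x z" "E x z'" "c z = c w" "c z' = c w" using T by auto
    have zS: "z \<in> S" "z' \<in> S" using z(2,3) cover xS by blast+
    have zV: "z \<in> V" "z' \<in> V" using zS S_V by blast+
    obtain c' where c': "refines V c' c" "equitable V E c'" "single c' z"
      "card (c' ` S) < card (c ` S) + 2"
      using zV(1) by (rule no_split)
    have "single c' x"
    proof (rule single_neighbour[OF c'(1-3) z(2)])
      fix b assume "E b z" "c b = c x"
      then show "b = x"
        using unique_neighbour[OF vu uS mono _ E_sym E_sym, of z b x] z u x by simp
    qed
    then have 1: "c' z' \<noteq> c' w" using separates[OF c'(2) _ z(3) nxw V(2)] by blast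
    have "z \<noteq> w" using z(2) nxw by blast
    then have 2: "c' z' \<noteq> c' z" "c' w \<noteq> c' z" using c'(3) zV V(2) z(1) by blast+
    have "card (c ` S) + 2 \<le> card (c' ` S)"
      by (rule gain_three[OF c'(1) zS(2) vw(3) zS(1) _ _ 1 2]) (use z in simp_all)
    then show False using c'(4) by linarith
  qed
  obtain y where y: "E v y" "y \<notin> S" using minimal by blast
  have yV: "y \<in> V" using y E_in by blast
  have cyw: "c y \<noteq> c w" using pureD y yV by blast
  note uniq = unique_neighbour[OF y mono]
  \<comment> \<open>Otherwise individualizing \<open>z\<close> separates it from \<open>s\<close>
    and isolates \<open>a\<close>, which in turn splits the class of \<open>w\<close>: two new
    colors.\<close>
  have sole: "s = z"
    if z: "E a z" "c z = c y" "c a = c v" "a \<notin> S" and s: "s \<in> S" "c s = c y" for a z s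
  proof (rule ccontr)
    assume ne: "s \<noteq> z"
    have zS: "z \<in> S" using z cover by blast
    have aV: "a \<in> V" "z \<in> V" "s \<in> V" using z E_in s S_V by blast+
    obtain c' where c': "refines V c' c" "equitable V E c'" "single c' z"
      "card (c' ` S) < card (c ` S) + 2"
      using aV(2) by (rule no_split)
    have sg: "single c' a"
    proof (rule single_neighbour[OF c'(1-3) z(1)])
      fix b assume "E b z" "c b = c a"
      then show "b = a" using uniq[OF z(2) E_sym E_sym, of b a] z by simp
    qed
    obtain d where d: "d \<in> V" "E a d" "c d = c w" using transfer[OF vw(1) aV(1) z(3)] by blast
    obtain d' where d': "d' \<in> V" "c d' = c d" "\<not> E a d'" using nontrivial[OF d(2)] by blast
    have dS: "d \<in> S" "d' \<in> S" using pureD d d' by auto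
    have 1: "c' d \<noteq> c' d'" using separates[OF c'(2) sg d(2) d'(3,1)] .
    have 2: "c' s \<noteq> c' z" using c'(3) ne aV by blast
    have "card (c ` S) + 2 \<le> card (c' ` S)"
      by (rule gain_pairs[OF c'(1) s(1) zS dS _ _ _ 2 1]) (use z s d d' cyw in simp_all)
    then show False using c'(4) by linarith
  qed
  \<comment> \<open>By \<open>sole\<close>, two vertices outside \<open>S\<close> in the class of
    \<open>v\<close> would share a neighbour in the class of \<open>y\<close>, which has only one
    neighbour in the class of \<open>v\<close>.\<close>
  have two: "u = v \<or> u = x" if u: "u \<in> V" "c u = c v" for u
  proof (rule ccontr)
    assume n: "\<not> ?thesis"
    then have uS: "u \<notin> S" using mono u by blast
    obtain z where z: "z \<in> S" "E x z" "c z = c y" using other[OF y(1) x(1,2) xS] by blast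
    obtain z' where z': "z' \<in> S" "E u z'" "c z' = c y" using other[OF y(1) u uS] by blast
    have "z' = z" using sole[OF z(2,3) x(2) xS z'(1,3)] .
    then have "u = x" using uniq[OF z(3) E_sym E_sym, of u x] z z' x u by simp
    then show False using n by blast
  qed
  have one: "(E d v \<or> E d x) \<and> \<not> (E d v \<and> E d x)" if d: "d \<in> V" "c d = c w" for d
  proof -
    obtain a where a: "a \<in> V" "E d a" "c a = c v" using transfer[OF E_sym[OF vw(1)] d] by blast
    obtain b where b: "b \<in> V" "c b = c v" "\<not> E d b" using nontrivial[OF a(2)] a(3) by auto
    show ?thesis using two[OF a(1,3)] two[OF b(1,2)] a(2) b(3) by blast
  qed
  obtain w' where w': "w' \<in> S" "E x w'" "c w' = c w" using other[OF vw(1) x(1,2) xS] by blast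
  have w'V: "w' \<in> V" using w' S_V by blast
  have nvw': "\<not> E v w'" using one[OF w'V w'(3)] E_sym[OF w'(2)] E_sym[of v w'] by blast
  have w'w: "w' \<noteq> w" using nvw' vw by blast
  \<comment> \<open>Individualizing \<open>w\<close> isolates \<open>v\<close>, and a second
    neighbour \<open>d\<close> of \<open>v\<close> would turn \<open>w\<close>, \<open>w'\<close>,
    \<open>d\<close> into three colors.\<close>
  have nw: "d = w" if d: "E v d" "c d = c w" for d
  proof (rule ccontr)
    assume ne: "d \<noteq> w"
    have dV: "d \<in> V" using d E_in by blast
    then have dS: "d \<in> S" using pureD d by blast
    obtain c' where c': "refines V c' c" "equitable V E c'" "single c' w"
      "card (c' ` S) < card (c ` S) + 2"
      using V(2) by (rule no_split)
    have "single c' v"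
    proof (rule single_neighbour[OF c'(1-3) vw(1)])
      fix b assume b: "E b w" "c b = c v"
      then show "b = v" using two[of b] E_in[of b w] nxw by blast
    qed
    then have 1: "c' d \<noteq> c' w'" using separates[OF c'(2) _ d(1) nvw' w'V] by blast
    have 2: "c' d \<noteq> c' w" "c' w' \<noteq> c' w" using c'(3) ne w'w dV w'V by blast+
    have "card (c ` S) + 2 \<le> card (c' ` S)"
      by (rule gain_three[OF c'(1) dS w'(1) vw(3) _ _ 1 2]) (use d w' in simp_all)
    then show False using c'(4) by linarith
  qed
  have nw': "d = w'" if d: "E x d" "c d = c w" for d
  proof -
    have "{z \<in> V. E v z \<and> c z = c w} = {w}" using nw vw V by blast
    then have "card {z \<in> V. E x z \<and> c z = c w} = 1"
      using degree_eq[of x v "c w"] x V by simp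
    then obtain t where t: "{z \<in> V. E x z \<and> c z = c w} = {t}" by (rule card_1_singletonE)
    have "d \<in> {z \<in> V. E x z \<and> c z = c w}" "w' \<in> {z \<in> V. E x z \<and> c z = c w}"
      using d w' w'V E_in by blast+
    then show ?thesis unfolding t by simp
  qed
  have twow: "u = w \<or> u = w'" if u: "u \<in> V" "c u = c w" for u
    using one[OF u] nw[OF _ u(2)] nw'[OF _ u(2)] E_sym by blast
  show thesis
    by (rule that[OF x(1) w'(1) xS x(2) w'(3) w'w two twow w'(2) nxw nvw'])
qed

text \<open>By \<open>no_fat_edge\<close> and \<open>no_inner_edge\<close> one end of the edge is
  alone in \<open>S\<close> within its class and takes the role of \<open>v\<close>. Which end it is
  remains open; it can be recognized later because the class of \<open>v\<close> is mixed and that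
  of \<open>w\<close> lies in \<open>S\<close>.\<close>

lemma cover_edge_cases:
  assumes min: "\<forall>v\<in>S. \<exists>y. E v y \<and> y \<notin> S" and st: "E s t" "s \<in> S" "t \<in> S"
  obtains v w x w' where "(v = s \<and> w = t) \<or> (v = t \<and> w = s)"
    "x \<in> V" "w' \<in> S" "x \<notin> S" "c x = c v" "c w' = c w" "w' \<noteq> w"
    "\<And>u. u \<in> V \<Longrightarrow> c u = c v \<Longrightarrow> u = v \<or> u = x"
    "\<And>u. u \<in> V \<Longrightarrow> c u = c w \<Longrightarrow> u = w \<or> u = w'"
    "E x w'" "\<not> E x w" "\<not> E v w'"
proof (cases "\<forall>a\<in>S. c a = c s \<longrightarrow> a = s")
  case True
  have "\<exists>y. E s y \<and> y \<notin> S" using min st(2) by blast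
  then show thesis by (rule mono_cover_edge[OF st True]) (rule that[of s t], simp_all)
next
  case False
  then have *: "\<forall>a\<in>S. c a = c t \<longrightarrow> a = t"
    using no_fat_edge[OF st] no_inner_edge[OF st] by blast
  have "\<exists>y. E t y \<and> y \<notin> S" using min st(3) by blast
  then show thesis
    by (rule mono_cover_edge[OF E_sym[OF st(1)] st(3,2) *]) (rule that[of t s], simp_all)
qed

section \<open>Mixed classes and purity\<close>

definition mixed :: "('v \<Rightarrow> 'k) \<Rightarrow> 'v \<Rightarrow> bool" where
  "mixed c' p \<longleftrightarrow> (\<exists>a\<in>S. c' a = c' p) \<and> (\<exists>b\<in>V - S. c' b = c' p)"

text \<open>A vertex of the class of \<open>p\<close> outside \<open>S\<close> has a neighbour in
  the class of \<open>q\<close>, which must be in \<open>S\<close>; not being mixed, that class lies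
  in \<open>S\<close> entirely. A vertex of the class of \<open>p\<close> inside \<open>S\<close>
  then provides an edge inside \<open>S\<close>.\<close>

lemma mixed_boundary:
  assumes "equitable V E c'" "E p q" "mixed c' p" "\<not> mixed c' q"
  obtains p' q' where "p' \<in> S" "q' \<in> S" "E p' q'" "c' p' = c' p" "c' q' = c' q"
    "\<forall>u\<in>V. c' u = c' q \<longrightarrow> u \<in> S"
proof -
  have V: "p \<in> V" "q \<in> V" using E_in assms(2) by blast+
  obtain a b where a: "a \<in> S" "c' a = c' p" and b: "b \<in> V" "b \<notin> S" "c' b = c' p"
    using assms(3) unfolding mixed_def by blast
  have "a \<in> V" using a S_V by blast
  then obtain q' where q': "q' \<in> V" "E a q'" "c' q' = c' q"
    using equitable_transfer[OF finite_V assms(1) V(1) _ a(2) assms(2) V(2)] by blast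
  obtain r where "E b r" "c' r = c' q"
    using equitable_transfer[OF finite_V assms(1) V(1) b(1,3) assms(2) V(2)] by blast
  then have "r \<in> S" "c' r = c' q" using cover b by blast+
  then have *: "\<forall>u\<in>V. c' u = c' q \<longrightarrow> u \<in> S" using assms(4) unfolding mixed_def by blast
  then show thesis using that[OF a(1) _ q'(2) a(2) q'(3)] q' by blast
qed

lemma pure_if_no_mixed: "\<not> pure V S c' \<Longrightarrow> \<exists>p\<in>V. mixed c' p"
proof -
  assume "\<not> pure V S c'"
  then obtain x y where "x \<in> S" "y \<in> V - S" "c' x = c' y" unfolding pure_def by blast
  then have "mixed c' x" "x \<in> V" using S_V unfolding mixed_def by auto
  then show ?thesis by blast
qed

text \<open>The set \<open>Z\<close> of all vertices of mixed classes of \<open>c'\<close>, extended by the classes inside \<open>S\<close>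
  that were not split and the classes outside \<open>S\<close> attached to those, has no edges leaving it.\<close>

lemma pure_if_stuck_edge:
  assumes min: "\<forall>v\<in>S. \<exists>y. E v y \<and> y \<notin> S" and st: "E s t" "s \<in> S" "t \<in> S"
  shows "pure V S c"
proof (rule ccontr)
  assume np: "\<not> pure V S c"
  obtain w w' where w: "w \<in> S" "w' \<in> S" "w' \<noteq> w" "c w' = c w"
    and tw: "\<And>u. u \<in> V \<Longrightarrow> c u = c w \<Longrightarrow> u = w \<or> u = w'"
    by (rule cover_edge_cases[OF min st]) (use st in metis)
  have wV: "w \<in> V" "w' \<in> V" using w S_V by blast+
  obtain c' where ind: "individualizes V E w c c'" and card: "card (c' ` S) < card (c ` S) + 2"
    and np': "\<not> pure V S c'" using stuck[OF wV(1)] np by blast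
  then have c': "refines V c' c" "equitable V E c'" "single c' w"
    unfolding individualizes_def by blast+
  have ref: "c a = c b" if "c' a = c' b" "a \<in> V" "b \<in> V" for a b
    using c'(1) that unfolding refines_def by blast
  \<comment> \<open>The class of \<open>w\<close> has only two vertices, so isolating one isolates
    the other.\<close>
  have sw': "single c' w'"
  proof (intro ballI impI)
    fix u assume u: "u \<in> V" "c' u = c' w'"
    have "u \<noteq> w" using c'(3) u(2) wV(2) w(3) by metis
    then show "u = w'" using tw[OF u(1)] ref[OF u(2) u(1) wV(2)] w(4) by simp
  qed
  \<comment> \<open>Separating \<open>w\<close> from \<open>w'\<close> already uses up the one color
    that may be gained.\<close>
  have unsplit: "c' a = c' b" if ab: "a \<in> S" "b \<in> S" "c a = c b" "c a \<noteq> c w" for a b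
  proof (rule ccontr)
    assume n: "c' a \<noteq> c' b"
    have "c' w' \<noteq> c' w" using c'(3) wV w(3) by blast
    then have "card (c ` S) + 2 \<le> card (c' ` S)"
      using gain_pairs[OF c'(1) ab(1,2) w(2,1) ab(3) w(4) _ n] ab(4) w(4) by simp
    then show False using card by linarith
  qed
  define Z2 where "Z2 = {p \<in> S. (\<forall>u\<in>V. c u = c p \<longrightarrow> u \<in> S) \<and> c p \<noteq> c w}"
  define Z3 where "Z3 = {p \<in> V - S. (\<forall>u\<in>V. c u = c p \<longrightarrow> u \<notin> S) \<and> (\<exists>q\<in>Z2. E p q)}"
  define Z where "Z = {p \<in> V. mixed c' p} \<union> Z2 \<union> Z3"
  have "w \<notin> Z"
  proof -
    have "\<not> mixed c' w" using c'(3) w(1) unfolding mixed_def by blast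
    then show ?thesis using w(1) unfolding Z_def Z2_def Z3_def by blast
  qed
  moreover have "Z \<subseteq> V" using S_V unfolding Z_def Z2_def Z3_def by blast
  moreover have "Z \<noteq> {}" using pure_if_no_mixed[OF np'] unfolding Z_def by blast
  ultimately obtain p q where pq: "p \<in> Z" "q \<in> V" "q \<notin> Z" "E p q"
    using connected[of Z] wV(1) by blast
  then have nq: "\<not> mixed c' q" and pV: "p \<in> V" using E_in unfolding Z_def by blast+
  consider "mixed c' p" | "p \<in> Z2" | "p \<in> Z3" using pq(1) unfolding Z_def by blast
  then show False
  proof cases
    case 1
    obtain p' q' where pq': "p' \<in> S" "q' \<in> S" "E p' q'" "c' p' = c' p" "c' q' = c' q"
      and qS: "\<forall>u\<in>V. c' u = c' q \<longrightarrow> u \<in> S"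
      by (rule mixed_boundary[OF c'(2) pq(4) 1 nq])
    have V': "p' \<in> V" "q' \<in> V" using pq' S_V by blast+
    obtain b where b: "b \<in> V" "b \<notin> S" "c' b = c' p'"
      using 1 pq'(4) unfolding mixed_def by auto
    have cb: "c b = c p'" using ref b V' by blast
    have cq: "c q' = c q" using ref pq'(5) V' pq(2) by blast
    obtain v0 w0 x0 w0' where h: "(v0 = p' \<and> w0 = q') \<or> (v0 = q' \<and> w0 = p')"
      "w0' \<in> S" "x0 \<notin> S" "c w0' = c w0"
      "\<And>u. u \<in> V \<Longrightarrow> c u = c v0 \<Longrightarrow> u = v0 \<or> u = x0"
      "\<And>u. u \<in> V \<Longrightarrow> c u = c w0 \<Longrightarrow> u = w0 \<or> u = w0'"
      "\<not> E x0 w0"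
      by (rule cover_edge_cases[OF min pq'(3,1,2)]) (rule that, assumption+)
    \<comment> \<open>The class of \<open>p'\<close> contains \<open>b\<close> outside
      \<open>S\<close>, so \<open>p'\<close> has the mixed role and \<open>b\<close> is its partner.
      The other end \<open>q'\<close> turns out to be in \<open>Z2\<close>.\<close>
    have "w0 \<noteq> p'" using h(6)[OF b(1)] cb b(2) pq'(1) h(2) by auto
    then have vw: "v0 = p'" "w0 = q'" using h(1) by blast+
    have "b = x0" using h(5)[OF b(1)] cb vw b(2) pq'(1) by auto
    then have nb: "\<not> E b q'" using h(7) vw by simp
    have "c q' \<noteq> c w"
    proof
      assume "c q' = c w"
      then have "q' = w \<or> q' = w'" using tw V' by blast
      then have "single c' q'" using c'(3) sw' by blast
      then show False
        using equitable_separates[OF finite_V c'(2) _ V'(2,1) b(1) pq'(3) nb] b(3) by simp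
    qed
    moreover have "u \<in> S" if u: "u \<in> V" "c u = c q" for u
      using h(6)[OF u(1)] u(2) cq vw(2) pq'(2) h(2) by auto
    moreover have "q \<in> S" using qS pq(2) by blast
    ultimately have "q \<in> Z2" using cq unfolding Z2_def by simp
    then show False using pq(3) unfolding Z_def by blast
  next
    case 2
    then have p: "p \<in> S" "\<And>u. u \<in> V \<Longrightarrow> c u = c p \<Longrightarrow> u \<in> S" "c p \<noteq> c w"
      unfolding Z2_def by blast+
    have "\<exists>u\<in>V. c u = c q \<and> u \<in> S"
    proof (rule ccontr)
      assume n: "\<not> ?thesis"
      then have "q \<in> Z3" using pq(2) 2 E_sym[OF pq(4)] unfolding Z3_def by blast
      then show False using pq(3) unfolding Z_def by blast
    qed
    then obtain u where u: "u \<in> V" "c u = c q" "u \<in> S" by blast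
    obtain r where r: "r \<in> V" "E u r" "c r = c p"
      using transfer[OF E_sym[OF pq(4)] u(1,2)] by blast
    then have rS: "r \<in> S" using p(2) by blast
    obtain v0 w0 x0 w0' where h: "(v0 = u \<and> w0 = r) \<or> (v0 = r \<and> w0 = u)"
      "x0 \<in> V" "w0' \<in> S" "x0 \<notin> S" "c x0 = c v0" "c w0' = c w0"
      "\<And>u. u \<in> V \<Longrightarrow> c u = c v0 \<Longrightarrow> u = v0 \<or> u = x0"
      "\<not> E v0 w0'"
      by (rule cover_edge_cases[OF min r(2) u(3) rS]) (rule that, assumption+)
    \<comment> \<open>The class of \<open>r\<close> lies in \<open>S\<close>, so the mixed role
      falls to \<open>u\<close>.\<close>
    have "v0 \<noteq> r" using p(2)[OF h(2)] h(4,5) r(3) by auto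
    then have vw: "v0 = u" "w0 = r" using h(1) by blast+
    have "c' u \<noteq> c' x0"
    proof
      assume e: "c' u = c' x0"
      have "q = u \<or> q = x0" using h(7)[OF pq(2)] u vw by simp
      then have "mixed c' q" using e u(3) h(2,4) unfolding mixed_def by auto
      then show False using nq by blast
    qed
    then have su: "\<forall>y\<in>V. c' y = c' u \<longrightarrow> y = u"
      using h(7) ref u(1) vw(1) by metis
    have w0V: "w0' \<in> V" using h(3) S_V by blast
    \<comment> \<open>Since \<open>q\<close> is not mixed, the class of \<open>u\<close> was split
      into single vertices; then \<open>u\<close> splits the class of \<open>r\<close> as well,
      against \<open>unsplit\<close>.\<close>
    have "c' r \<noteq> c' w0'" using separates[OF c'(2) su r(2) _ w0V] h(8) vw(1) by simp
    then show False using unsplit[OF rS h(3)] h(6) vw(2) r(3) p(3) by simp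
  next
    case 3
    then obtain r where p: "p \<notin> S" "\<And>u. u \<in> V \<Longrightarrow> c u = c p \<Longrightarrow> u \<notin> S" and r: "r \<in> Z2" "E p r"
      unfolding Z3_def by blast
    have r': "\<And>u. u \<in> V \<Longrightarrow> c u = c r \<Longrightarrow> u \<in> S" "c r \<noteq> c w" "r \<in> S"
      using r(1) unfolding Z2_def by blast+
    have qS: "u \<in> S" if u: "u \<in> V" "c u = c q" for u
    proof -
      obtain p1 where "E u p1" "c p1 = c p" using transfer[OF E_sym[OF pq(4)] u] by blast
      then show ?thesis using p(2) cover E_in by blast
    qed
    \<comment> \<open>By elimination \<open>q\<close> belongs to the class of \<open>w\<close>.
      Individualizing \<open>p\<close> would then split both this class and that of
      \<open>r\<close>.\<close>
    have "q \<notin> Z2" using pq(3) unfolding Z_def by blast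
    then have "c q = c w" using qS pq(2) unfolding Z2_def by blast
    then have qr: "c q \<noteq> c r" using r'(2) by simp
    obtain d where d: "refines V d c" "equitable V E d" "single d p"
      "card (d ` S) < card (c ` S) + 2" using pV by (rule no_split)
    obtain q1 where q1: "q1 \<in> V" "c q1 = c q" "\<not> E p q1" using nontrivial[OF pq(4)] by blast
    obtain r1 where r1: "r1 \<in> V" "c r1 = c r" "\<not> E p r1" using nontrivial[OF r(2)] by blast
    have "q \<in> S" "q1 \<in> S" "r1 \<in> S" using qS pq(2) q1 r1 r'(1) by blast+
    then have "card (c ` S) + 2 \<le> card (d ` S)"
      by (intro gain_pairs[OF d(1) _ _ r'(3) _ q1(2)[symmetric] r1(2)[symmetric] qr
          separates[OF d(2,3) pq(4) q1(3,1)] separates[OF d(2,3) r(2) r1(3,1)]])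
    then show False using d(4) by linarith
  qed
qed

text \<open>If \<open>c\<close> is not pure, no edge lies inside \<open>S\<close>, so mixedness
  under \<open>c'\<close> spreads along every edge and hence to all vertices. But the individualized
  \<open>t\<close> is alone in its class.\<close>

lemma pure_if_stuck:
  assumes min: "\<not> pure V S c \<longrightarrow> (\<forall>v\<in>S. \<exists>y. E v y \<and> y \<notin> S)"
  shows "pure V S c"
proof (rule ccontr)
  assume np: "\<not> pure V S c"
  have none: False if "E s t" "s \<in> S" "t \<in> S" for s t
    using pure_if_stuck_edge[OF mp[OF min np] that] np by blast
  obtain t where t: "t \<in> V" using two_vertices by blast
  obtain c' where ind: "individualizes V E t c c'" and np': "\<not> pure V S c'"
    using stuck[OF t] np by blast
  then have c': "equitable V E c'" "single c' t" unfolding individualizes_def by blast+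
  define Z where "Z = {p \<in> V. mixed c' p}"
  have "\<not> mixed c' t" using c'(2) S_V unfolding mixed_def by blast
  then have "Z \<noteq> V" using t unfolding Z_def by blast
  moreover have "Z \<noteq> {}" using pure_if_no_mixed[OF np'] unfolding Z_def by blast
  moreover have "Z \<subseteq> V" unfolding Z_def by blast
  ultimately obtain p q where "E p q" "mixed c' p" "\<not> mixed c' q"
    using connected[of Z] unfolding Z_def by blast
  then show False by (rule mixed_boundary[OF c'(1)]) (rule none)
qed

text \<open>Two vertices outside \<open>S\<close> are found for which all four combinations of
  adjacency occur inside \<open>S\<close>. As \<open>S\<close> is a single class, individualizing
  both gains three colors.\<close>

lemma crossing_pair:
  assumes pure: "pure V S c"
  shows "\<exists>x\<in>V. \<exists>y\<in>V. \<forall>c' c''. individualizes V E x c c' \<longrightarrow> individualizes V E y c' c'' \<longrightarrow>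
    card (c ` S) + 3 \<le> card (c'' ` S)"
proof -
  have cls: "u \<in> S" if "u \<in> V" "s \<in> S" "c u = c s" for u s
    using pure that unfolding pure_def by (metis DiffI)
  have none: False if st: "E s t" "s \<in> S" "t \<in> S" for s t
  proof (cases "c s = c t")
    case True
    then show False using no_inner_edge[OF st] by blast
  next
    case False
    \<comment> \<open>By purity the non-neighbours from \<open>nontrivial\<close> are in
      \<open>S\<close> as well, so both classes have two vertices in \<open>S\<close>.\<close>
    obtain t' where t': "t' \<in> V" "c t' = c t" "\<not> E s t'" using nontrivial[OF st(1)] by blast
    obtain s' where s': "s' \<in> V" "c s' = c s" "\<not> E t s'"
      using nontrivial[OF E_sym[OF st(1)]] by blast
    have "s' \<in> S" "t' \<in> S" using cls s' t' st by blast+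
    moreover have "s' \<noteq> s" "t' \<noteq> t" using s' t' st E_sym by blast+
    ultimately show False using no_fat_edge[OF st False] s' t' by blast
  qed
  obtain a b where "a \<in> V" "b \<in> V" "a \<noteq> b" using two_vertices by blast
  then have "\<exists>p\<in>{a}. \<exists>q\<in>V - {a}. E p q" by (intro connected) auto
  then obtain s y where s: "s \<in> S" "y \<in> V" "y \<notin> S" "E y s"
    using cover none E_in E_sym by blast
  \<comment> \<open>No edge leaves this set: a vertex outside \<open>S\<close> with neighbours in
    two classes inside \<open>S\<close> would split both when individualized. Hence \<open>S\<close>
    is a single class.\<close>
  define Z where "Z = {p \<in> S. c p = c s} \<union> {q \<in> V - S. \<exists>p\<in>S. c p = c s \<and> E q p}"
  have "Z = V"
  proof (rule ccontr)
    assume "Z \<noteq> V"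
    moreover have "Z \<subseteq> V" "Z \<noteq> {}" using S_V s unfolding Z_def by blast+
    ultimately obtain p q where pq: "p \<in> Z" "q \<in> V" "q \<notin> Z" "E p q"
      using connected by blast
    show False
    proof (cases "p \<in> S")
      case True
      then have "q \<notin> S" "c p = c s" using none pq unfolding Z_def by blast+
      then show False using pq True E_sym[OF pq(4)] unfolding Z_def by blast
    next
      case False
      then obtain r where r: "r \<in> S" "c r = c s" "E p r" using pq(1) unfolding Z_def by blast
      have q: "q \<in> S" "c q \<noteq> c s" using cover[OF pq(4)] False pq(2,3) unfolding Z_def by blast+
      have pV: "p \<in> V" using pq E_in by blast
      obtain d where d: "refines V d c" "equitable V E d" "single d p"
        "card (d ` S) < card (c ` S) + 2" using pV by (rule no_split)
      obtain q1 where q1: "q1 \<in> V" "c q1 = c q" "\<not> E p q1" using nontrivial[OF pq(4)] by blast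
      obtain r1 where r1: "r1 \<in> V" "c r1 = c r" "\<not> E p r1" using nontrivial[OF r(3)] by blast
      have "q1 \<in> S" "r1 \<in> S" using cls q1 r1 q r by blast+
      moreover have "c q \<noteq> c r" using q(2) r(2) by simp
      ultimately have "card (c ` S) + 2 \<le> card (d ` S)"
        by (intro gain_pairs[OF d(1) q(1) _ r(1) _ q1(2)[symmetric] r1(2)[symmetric] _
            separates[OF d(2,3) pq(4) q1(3,1)] separates[OF d(2,3) r(3) r1(3,1)]])
      then show False using d(4) by linarith
    qed
  qed
  then have col: "c u = c s" if "u \<in> S" for u using that S_V unfolding Z_def by blast
  define N where "N u = {z \<in> V. E u z}" for u
  have NS: "N u \<subseteq> S" if "u \<notin> S" for u using cover that unfolding N_def by blast
  have half: "2 * card (N u) \<le> card S" if u: "u \<in> V" "u \<notin> S" "N u \<noteq> {}" for u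
  proof -
    obtain z where z: "E u z" "z \<in> S" using u(3) NS[OF u(2)] unfolding N_def by blast
    have "c u \<noteq> c z" using cls[OF u(1) z(2)] u(2) by blast
    then have "2 * card {r \<in> V. E u r \<and> c r = c z} \<le> card {r \<in> V. c r = c z}"
      by (intro not_dense[OF z(1)]) (use cls z(2) in blast)+
    moreover have "{r \<in> V. E u r \<and> c r = c z} = N u"
      using NS[OF u(2)] col z(2) unfolding N_def by auto
    moreover have "{r \<in> V. c r = c z} = S" using cls col z(2) S_V by auto
    ultimately show ?thesis by simp
  qed
  \<comment> \<open>A largest neighbourhood is properly contained in no other one.\<close>
  have "\<exists>x. (x \<in> V \<and> x \<notin> S) \<and> (\<forall>y. y \<in> V \<and> y \<notin> S \<longrightarrow> card (N y) \<le> card (N x))"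
    by (rule ex_has_greatest_nat[of _ y _ "Suc (card V)"])
      (use s finite_V in \<open>auto simp: N_def intro!: le_imp_less_Suc card_mono\<close>)
  then obtain x where x: "x \<in> V" "x \<notin> S"
    and max: "\<And>y. y \<in> V \<Longrightarrow> y \<notin> S \<Longrightarrow> card (N y) \<le> card (N x)" by blast
  have fin: "finite (N u)" for u unfolding N_def using finite_V by simp
  have "N y \<noteq> {}" using s S_V unfolding N_def by blast
  then have pos: "card (N x) > 0"
    using max[OF s(2,3)] fin[of y] by (metis card_gt_0_iff le_zero_eq not_gr0)
  then have "N x \<noteq> {}" by auto
  moreover from this have "N x \<noteq> S" using half[OF x] pos by auto
  ultimately have Nx: "N x \<noteq> {}" "N x \<noteq> S" .
  \<comment> \<open>An edge leaving \<open>Y\<close> starts at a vertex \<open>p\<close> outside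
    \<open>S\<close> whose neighbourhood meets \<open>N x\<close> without being contained in
    it.\<close>
  define Y where "Y = N x \<union> {q \<in> V - S. N q \<inter> N x \<noteq> {}}"
  have "Y \<noteq> V" using Nx(2) NS[OF x(2)] S_V unfolding Y_def by blast
  moreover have "Y \<subseteq> V" "Y \<noteq> {}" using Nx unfolding Y_def N_def by blast+
  ultimately obtain p q where pq: "p \<in> Y" "q \<in> V" "q \<notin> Y" "E p q" using connected by blast
  have "p \<notin> S"
  proof
    assume "p \<in> S"
    then have "p \<in> N x" "q \<notin> S" using pq none[OF pq(4)] unfolding Y_def by blast+
    then have "q \<in> Y" using pq E_sym[OF pq(4)] unfolding Y_def N_def by blast
    then show False using pq by blast
  qed
  then have p: "p \<in> V" "p \<notin> S" "N p \<inter> N x \<noteq> {}" "q \<in> N p" "q \<notin> N x" "q \<in> S"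
    using pq NS[OF x(2)] NS[of p] unfolding Y_def N_def by blast+
  obtain a where a: "a \<in> N p" "a \<in> N x" using p(3) by blast
  have "\<not> N x \<subseteq> N p"
  proof
    assume "N x \<subseteq> N p"
    then have "N x \<subset> N p" using p by blast
    then have "card (N x) < card (N p)" using fin by (intro psubset_card_mono)
    then show False using max[OF p(1,2)] by simp
  qed
  then obtain b where b: "b \<in> N x" "b \<notin> N p" by blast
  \<comment> \<open>Both neighbourhoods have at most half the size of \<open>S\<close> and they
    overlap, so their union misses a vertex of \<open>S\<close>.\<close>
  have "\<not> S \<subseteq> N x \<union> N p"
  proof
    assume "S \<subseteq> N x \<union> N p"
    then have "card S \<le> card (N x \<union> N p)" using fin by (intro card_mono) auto
    moreover have "card (N x \<union> N p) + card (N x \<inter> N p) = card (N x) + card (N p)"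
      using card_Un_Int[OF fin fin] by simp
    moreover have "card (N x \<inter> N p) > 0" using fin p(3) by (auto simp: card_gt_0_iff)
    moreover have "2 * card (N x) \<le> card S" "2 * card (N p) \<le> card S"
      using half x p Nx by blast+
    ultimately show False by linarith
  qed
  then obtain e where e: "e \<in> S" "e \<notin> N x" "e \<notin> N p" by blast
  have S: "a \<in> S" "b \<in> S" using a b NS x(2) by blast+
  have V: "a \<in> V" "b \<in> V" "q \<in> V" "e \<in> V" using S e p S_V by blast+
  have "card (c ` S) + 3 \<le> card (c'' ` S)"
    if i: "individualizes V E x c c'" "individualizes V E p c' c''" for c' c''
  proof -
    have r: "refines V c'' c'" "refines V c' c" "equitable V E c''" "single c' x" "single c'' p"
      using i unfolding individualizes_def by blast+
    have sx: "single c'' x" using r(1,4) x(1) unfolding refines_def by blast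
    have ne: "c'' f \<noteq> c'' g" if "f \<in> N u" "g \<notin> N u" "g \<in> V" "single c'' u" for f g u
      using separates[OF r(3) that(4), of f g] that unfolding N_def by blast
    have "card (c'' ` {a, b, q, e}) = 4"
      using ne[OF a(1) b(2) V(2) r(5)] ne[OF a(2) p(5) V(3) sx] ne[OF a(2) e(2) V(4) sx]
        ne[OF b(1) p(5) V(3) sx] ne[OF b(1) e(2) V(4) sx] ne[OF p(4) e(3) V(4) r(5)] by simp
    moreover have "card (c ` {a, b, q, e}) = 1" using col S e(1) p(6) by simp
    moreover have "{a, b, q, e} \<subseteq> S" using S e p by blast
    ultimately show ?thesis
      using refines_card_image[OF refines_trans[OF r(1,2)] S_V finite_S, of "{a, b, q, e}"]
      by simp
  qed
  then show ?thesis using x(1) p(1) by blast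
qed

end

text \<open>If no single vertex guarantees progress, the coloring is pure, and the three colors
  gained by a crossing pair are worth 6, the price of two individualizations.\<close>

lemma (in reduced_coloring) potential_step:
  assumes min: "\<not> pure V S c \<longrightarrow> (\<forall>v\<in>S. \<exists>y. E v y \<and> y \<notin> S)"
  shows "(\<exists>x\<in>V. \<forall>c'. individualizes V E x c c' \<longrightarrow> potential V S c' + 3 \<le> potential V S c) \<or>
    (\<exists>x\<in>V. \<exists>y\<in>V. \<forall>c' c''. individualizes V E x c c' \<longrightarrow> individualizes V E y c' c'' \<longrightarrow>
      potential V S c'' + 6 \<le> potential V S c)"
proof (cases "\<exists>x\<in>V. \<forall>c'. individualizes V E x c c' \<longrightarrow>
    card (c ` S) + 2 \<le> card (c' ` S) \<or> \<not> pure V S c \<and> pure V S c'")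
  case True
  then obtain x where x: "x \<in> V" "\<And>c'. individualizes V E x c c' \<Longrightarrow>
    card (c ` S) + 2 \<le> card (c' ` S) \<or> \<not> pure V S c \<and> pure V S c'" by blast
  have "potential V S c' + 3 \<le> potential V S c" if i: "individualizes V E x c c'" for c'
  proof -
    have r: "refines V c' c" using i unfolding individualizes_def by blast
    show ?thesis
    proof (cases "card (c ` S) + 2 \<le> card (c' ` S)")
      case True
      then show ?thesis using potential_gain[OF r S_V finite_S True] by simp
    next
      case False
      then have "\<not> pure V S c" "pure V S c'" using x(2)[OF i] by blast+
      moreover have "card (c ` S) \<le> card (c' ` S)"
        using refines_card_image[OF r S_V finite_S, of "{}"] by simp
      ultimately show ?thesis unfolding potential_def by simp
    qed
  qed
  then show ?thesis using x(1) by blast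
next
  case False
  interpret stuck_coloring V E c S
    by unfold_locales (use False in \<open>meson not_le\<close>)
  obtain x y where xy: "x \<in> V" "y \<in> V" "\<And>c' c''. individualizes V E x c c' \<Longrightarrow>
    individualizes V E y c' c'' \<Longrightarrow> card (c ` S) + 3 \<le> card (c'' ` S)"
    using crossing_pair[OF pure_if_stuck[OF min]] by blast
  have "potential V S c'' + 6 \<le> potential V S c"
    if "individualizes V E x c c'" "individualizes V E y c' c''" for c' c''
  proof -
    have "refines V c'' c" using that refines_trans unfolding individualizes_def by blast
    from potential_gain[OF this S_V finite_S xy(3)[OF that]] show ?thesis by simp
  qed
  then show ?thesis using xy by blast
qed

section \<open>Flips\<close>

definition flip_relation ::
  "'v set \<Rightarrow> ('v \<Rightarrow> 'v \<Rightarrow> bool) \<Rightarrow> ('v \<Rightarrow> 'k) \<Rightarrow> ('k \<Rightarrow> 'k \<Rightarrow> bool) \<Rightarrow> 'v \<Rightarrow> 'v \<Rightarrow> bool" where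
  "flip_relation V E c f v w \<longleftrightarrow> v \<in> V \<and> w \<in> V \<and> v \<noteq> w \<and> E v w \<noteq> f (c v) (c w)"

definition pair_flip :: "'k \<Rightarrow> 'k \<Rightarrow> 'k \<Rightarrow> 'k \<Rightarrow> bool" where
  "pair_flip p q a b \<longleftrightarrow> a = p \<and> b = q \<or> a = q \<and> b = p"

definition arcs :: "'v set \<Rightarrow> ('v \<Rightarrow> 'v \<Rightarrow> bool) \<Rightarrow> ('v \<times> 'v) set" where
  "arcs V E = {(v, w). v \<in> V \<and> w \<in> V \<and> E v w}"

lemma finite_arcs: "finite V \<Longrightarrow> finite (arcs V E)"
  by (rule finite_subset[of _ "V \<times> V"]) (auto simp: arcs_def)

text \<open>Flipping complements a neighbourhood within a class, minus the vertex itself. Equally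
  colored vertices agree on whether they belong to the class of color \<open>k\<close>, so their new
  degrees agree too.\<close>

lemma equitable_flip:
  assumes "finite V" "equitable V E c" "\<And>x. \<not> E x x"
  shows "equitable V (flip_relation V E c f) c"
  unfolding equitable_def
proof (intro ballI impI allI)
  fix x y k assume xy: "x \<in> V" "y \<in> V" "c x = c y"
  define M where "M = {z \<in> V. c z = k}"
  have fin: "finite M" using assms(1) by (simp add: M_def)
  have deg: "card {z \<in> V. E x z \<and> c z = k} = card {z \<in> V. E y z \<and> c z = k}"
    using assms(2) xy unfolding equitable_def by blast
  have flipped: "card {z \<in> V. flip_relation V E c f u z \<and> c z = k} =
      (if f (c u) k then card (M - {u}) - card {z \<in> V. E u z \<and> c z = k}
       else card {z \<in> V. E u z \<and> c z = k})" if u: "u \<in> V" for u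
  proof (cases "f (c u) k")
    case True
    then have "{z \<in> V. flip_relation V E c f u z \<and> c z = k} =
        (M - {u}) - {z \<in> V. E u z \<and> c z = k}"
      using u by (auto simp: flip_relation_def M_def)
    moreover have "{z \<in> V. E u z \<and> c z = k} \<subseteq> M - {u}" using assms(3) by (auto simp: M_def)
    ultimately show ?thesis using True assms(1) by (simp add: card_Diff_subset)
  next
    case False
    then have "{z \<in> V. flip_relation V E c f u z \<and> c z = k} = {z \<in> V. E u z \<and> c z = k}"
      using u assms(3) by (auto simp: flip_relation_def)
    then show ?thesis using False by simp
  qed
  have "card (M - {x}) = card (M - {y})"
    using fin xy by (simp add: card_Diff_singleton_if M_def)
  then show "card {z \<in> V. flip_relation V E c f x z \<and> c z = k} =
      card {z \<in> V. flip_relation V E c f y z \<and> c z = k}"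
    using flipped[OF xy(1)] flipped[OF xy(2)] deg xy(3) by simp
qed

lemma arcs_flip_full:
  assumes V: "finite V" and xy: "x \<in> V" "y \<in> V" "E x y" "c x = p" "c y = p"
    and full: "\<And>u v. u \<in> V \<Longrightarrow> v \<in> V \<Longrightarrow> c u = p \<Longrightarrow> c v = p \<Longrightarrow> u \<noteq> v \<Longrightarrow> E u v"
  shows "card (arcs V (flip_relation V E c (pair_flip p p))) < card (arcs V E)"
proof (rule psubset_card_mono)
  show "finite (arcs V E)" using V by (rule finite_arcs)
  have "arcs V (flip_relation V E c (pair_flip p p)) \<subseteq> arcs V E"
    using full by (auto simp: arcs_def flip_relation_def pair_flip_def)
  moreover have "(x, y) \<in> arcs V E" "(x, y) \<notin> arcs V (flip_relation V E c (pair_flip p p))"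
    using xy by (auto simp: arcs_def flip_relation_def pair_flip_def)
  ultimately show "arcs V (flip_relation V E c (pair_flip p p)) \<subset> arcs V E" by blast
qed

text \<open>Each vertex of \<open>C\<close> is adjacent to more than half of \<open>D\<close> before
  the flip and to less than half afterwards; elsewhere no arcs appear.\<close>

lemma arcs_flip_dense:
  assumes V: "finite V" and sym: "\<And>u v. E u v \<Longrightarrow> E v u" and pq: "p \<noteq> q"
    and x: "x \<in> V" "c x = p"
    and dense: "\<And>v. v \<in> V \<Longrightarrow> c v = p \<Longrightarrow>
      card {w \<in> V. c w = q} < 2 * card {w \<in> V. E v w \<and> c w = q}"
  shows "card (arcs V (flip_relation V E c (pair_flip p q))) < card (arcs V E)"
proof -
  define C D where "C = {v \<in> V. c v = p}" and "D = {w \<in> V. c w = q}"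
  let ?F = "flip_relation V E c (pair_flip p q)"
  have F: "?F v w \<longleftrightarrow> \<not> E v w" if "v \<in> C" "w \<in> D" for v w
    using that pq by (auto simp: C_def D_def flip_relation_def pair_flip_def)
  have F_sym: "?F v w \<longleftrightarrow> ?F w v" for v w
    using sym by (auto simp: flip_relation_def pair_flip_def)
  have fin: "finite C" "finite D" using V by (simp_all add: C_def D_def)
  \<comment> \<open>As \<open>p\<close> and \<open>q\<close> differ, the arcs from \<open>C\<close>
    to \<open>D\<close> and those from \<open>D\<close> to \<open>C\<close> are disjoint mirror
    images.\<close>
  have parts: "card (arcs V R) =
      card (arcs V R - C \<times> D - D \<times> C) + 2 * card (Sigma C (\<lambda>v. {w \<in> D. R v w}))"
    if R: "\<And>v w. R v w \<longleftrightarrow> R w v" for R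
  proof -
    have 1: "arcs V R \<inter> C \<times> D = Sigma C (\<lambda>v. {w \<in> D. R v w})"
      by (auto simp: arcs_def C_def D_def)
    have 2: "arcs V R \<inter> D \<times> C = prod.swap ` (arcs V R \<inter> C \<times> D)"
    proof (intro equalityI subsetI)
      fix e assume "e \<in> arcs V R \<inter> D \<times> C"
      then have "prod.swap e \<in> arcs V R \<inter> C \<times> D" using R by (auto simp: arcs_def)
      then show "e \<in> prod.swap ` (arcs V R \<inter> C \<times> D)" by (metis image_eqI swap_swap)
    qed (use R in \<open>auto simp: arcs_def\<close>)
    have 3: "card (arcs V R \<inter> D \<times> C) = card (arcs V R \<inter> C \<times> D)"
      unfolding 2 by (rule card_image) simp
    have disj: "C \<times> D \<inter> D \<times> C = {}" using pq by (auto simp: C_def D_def)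
    have f: "finite (arcs V R)" using V by (rule finite_arcs)
    have "card (arcs V R) = card (arcs V R \<inter> C \<times> D) + card (arcs V R - C \<times> D)"
      using card_Int_Diff[OF f] by blast
    also have "card (arcs V R - C \<times> D) =
        card ((arcs V R - C \<times> D) \<inter> D \<times> C) + card (arcs V R - C \<times> D - D \<times> C)"
      using card_Int_Diff[of "arcs V R - C \<times> D"] f by blast
    also have "(arcs V R - C \<times> D) \<inter> D \<times> C = arcs V R \<inter> D \<times> C" using disj by blast
    finally show ?thesis using 1 3 by simp
  qed
  have "card (arcs V ?F - C \<times> D - D \<times> C) \<le> card (arcs V E - C \<times> D - D \<times> C)"
    using finite_arcs[OF V, of E]
    by (intro card_mono) (auto simp: arcs_def C_def D_def flip_relation_def pair_flip_def)
  moreover have "card (Sigma C (\<lambda>v. {w \<in> D. ?F v w})) < card (Sigma C (\<lambda>v. {w \<in> D. E v w}))"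
  proof -
    have "card {w \<in> D. ?F v w} < card {w \<in> D. E v w}" if v: "v \<in> C" for v
    proof -
      have "{w \<in> D. ?F v w} = D - {w \<in> D. E v w}" using F v by blast
      then have "card {w \<in> D. ?F v w} = card D - card {w \<in> D. E v w}"
        using fin by (simp add: card_Diff_subset)
      moreover have "{w \<in> D. E v w} = {w \<in> V. E v w \<and> c w = q}" by (auto simp: D_def)
      ultimately show ?thesis using dense[of v] v by (simp add: C_def D_def)
    qed
    moreover have "C \<noteq> {}" using x by (auto simp: C_def)
    ultimately show ?thesis using fin by (simp add: sum_strict_mono)
  qed
  moreover have "E v w \<longleftrightarrow> E w v" for v w using sym by blast
  note parts[of E, OF this] parts[of ?F, OF F_sym]
  ultimately show ?thesis by linarith
qed

section \<open>Color refinement and IRC trees\<close>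

text \<open>The round selected by \<open>LEAST\<close> exists: by \<open>inj\<close> each step
  refines, so an unstable round adds a color, which the finite set \<open>X\<close> allows only
  finitely often.\<close>

lemma stable_coloring_stable:
  assumes "finite X" and inj: "\<And>c x y. step c x = step c y \<Longrightarrow> c x = c y"
  shows "\<exists>n. stable_coloring X step c = (step ^^ n) c \<and> (\<forall>x\<in>X. \<forall>y\<in>X.
    (step ^^ n) c x = (step ^^ n) c y \<longleftrightarrow> (step ^^ Suc n) c x = (step ^^ Suc n) c y)"
proof -
  let ?P = "\<lambda>n. \<forall>x\<in>X. \<forall>y\<in>X.
    (step ^^ n) c x = (step ^^ n) c y \<longleftrightarrow> (step ^^ Suc n) c x = (step ^^ Suc n) c y"
  have ref: "(step ^^ n) c x = (step ^^ n) c y" if "(step ^^ Suc n) c x = (step ^^ Suc n) c y" for n x y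
    using inj[of "(step ^^ n) c" x y] that by simp
  have "\<exists>n. ?P n"
  proof (rule ccontr)
    assume n: "\<not> ?thesis"
    have "n \<le> card ((step ^^ n) c ` X)" for n
    proof (induction n)
      case (Suc n)
      obtain x y where xy: "x \<in> X" "y \<in> X" "(step ^^ n) c x = (step ^^ n) c y"
        "(step ^^ Suc n) c x \<noteq> (step ^^ Suc n) c y"
        using n ref by blast
      have "refines X ((step ^^ Suc n) c) ((step ^^ n) c)"
        using ref unfolding refines_def by blast
      from refines_card_image[OF this subset_refl assms(1), of "{x, y}"] xy Suc show ?case
        by simp
    qed simp
    from this[of "Suc (card X)"] card_image_le[OF assms(1), of "(step ^^ Suc (card X)) c"]
    show False by simp
  qed
  from LeastI_ex[OF this] show ?thesis unfolding stable_coloring_def by blast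
qed

section \<open>Simple graphs and one-dimensional refinement\<close>

lemma adj_verts: "simple_graph G \<Longrightarrow> adj G v w \<Longrightarrow> v \<in> verts G \<and> w \<in> verts G"
  unfolding simple_graph_def adj_def by blast

lemma adj_sym: "adj G v w \<Longrightarrow> adj G w v"
  by (simp add: adj_def insert_commute)

lemma adj_irrefl: "simple_graph G \<Longrightarrow> \<not> adj G v v"
proof
  assume G: "simple_graph G" "adj G v v"
  then have "card {v, v} = 2" unfolding simple_graph_def adj_def by blast
  then show False by simp
qed

lemma vertex_cover_adj:
  assumes "vertex_cover G S" "adj G v w"
  shows "v \<in> S \<or> w \<in> S"
proof -
  have "{v, w} \<inter> S \<noteq> {}" using assms unfolding vertex_cover_def adj_def by blast
  then show ?thesis by auto
qed

lemma simple_graph_edgeE: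
  assumes "simple_graph G" "e \<in> edges G"
  obtains v w where "e = {v, w}" "adj G v w"
proof -
  have "card e = 2" using assms unfolding simple_graph_def by blast
  then obtain v w where "e = {v, w}" by (meson card_2_iff)
  then show thesis using that[of v w] assms(2) by (simp add: adj_def)
qed

lemma vertex_coverI:
  assumes "simple_graph G" "S \<subseteq> verts G" "\<And>v w. adj G v w \<Longrightarrow> v \<in> S \<or> w \<in> S"
  shows "vertex_cover G S"
  unfolding vertex_cover_def
proof (intro conjI ballI)
  fix e assume "e \<in> edges G"
  with assms(1) obtain v w where "e = {v, w}" "adj G v w" by (rule simple_graph_edgeE)
  then show "e \<inter> S \<noteq> {}" using assms(3) by blast
qed (rule assms(2))

text \<open>Vertices with equal stable colors keep equal colors for one more round, and the multiset
  in that next color counts the neighbours of each color.\<close>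

lemma
  assumes "simple_graph G"
  shows refines_WL_1: "refines (verts G) (WL 1 G \<chi>) \<chi>"
    and equitable_WL_1: "equitable (verts G) (adj G) (WL 1 G \<chi>)"
proof -
  have fin: "finite (verts G)" using assms unfolding simple_graph_def by blast
  have inj: "c x = c y" if "cr_step G c x = cr_step G c y" for c :: "'a \<Rightarrow> 'b color" and x y
    using that unfolding cr_step_def by simp
  obtain n where n: "stable_coloring (verts G) (cr_step G) \<chi> = (cr_step G ^^ n) \<chi>"
    "\<And>x y. x \<in> verts G \<Longrightarrow> y \<in> verts G \<Longrightarrow>
      (cr_step G ^^ n) \<chi> x = (cr_step G ^^ n) \<chi> y \<longleftrightarrow>
      (cr_step G ^^ Suc n) \<chi> x = (cr_step G ^^ Suc n) \<chi> y"
    using stable_coloring_stable[of "verts G" "cr_step G" \<chi>, OF fin inj] by blast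
  define c where "c = (cr_step G ^^ n) \<chi>"
  have WL: "WL 1 G \<chi> = c" by (rule ext) (simp add: WL_def n(1) c_def)
  have "(cr_step G ^^ m) \<chi> x = (cr_step G ^^ m) \<chi> y \<Longrightarrow> \<chi> x = \<chi> y" for m x y
    by (induction m) (auto dest: inj)
  then show "refines (verts G) (WL 1 G \<chi>) \<chi>" unfolding WL c_def refines_def by blast
  have count: "count (image_mset c (mset_set {w \<in> verts G. adj G x w})) k =
      card {z \<in> verts G. adj G x z \<and> c z = k}" for x k
  proof -
    have "{z \<in> {w \<in> verts G. adj G x w}. k = c z} = {z \<in> verts G. adj G x z \<and> c z = k}"
      by blast
    then show ?thesis
      using fin by (simp add: count_image_mset' filter_mset_mset_set)
  qed
  show "equitable (verts G) (adj G) (WL 1 G \<chi>)"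
    unfolding equitable_def WL
  proof (intro ballI impI allI)
    fix x y k assume "x \<in> verts G" "y \<in> verts G" "c x = c y"
    then have "cr_step G c x = cr_step G c y" using n(2) unfolding c_def by simp
    then show "card {z \<in> verts G. adj G x z \<and> c z = k} = card {z \<in> verts G. adj G y z \<and> c z = k}"
      unfolding count[symmetric] cr_step_def by simp
  qed
qed

section \<open>Depth bounds for IRC trees\<close>

lemma root_leaf_paths_finite: "finite (root_leaf_paths T)"
  by (induction T) auto

lemma root_leaf_paths_nonempty: "root_leaf_paths T \<noteq> {}"
proof (induction T)
  case (Node a ts)
  show ?case
  proof (cases ts)
    case (Cons t ts')
    then have "root_leaf_paths t \<noteq> {}" using Node by simp
    then show ?thesis using Cons by auto
  qed simp
qed

lemma indiv_depth_le_iff: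
  "indiv_depth k T \<le> d \<longleftrightarrow> (\<forall>p\<in>root_leaf_paths T. length (filter (indiv_node k) p) \<le> d)"
  unfolding indiv_depth_def
  by (subst Max_le_iff) (auto simp: root_leaf_paths_finite root_leaf_paths_nonempty)

lemma indiv_depth_Node:
  assumes "\<forall>s\<in>set ts. indiv_depth k s \<le> d" "indiv_node k (Node a ts) \<Longrightarrow> 1 \<le> e"
  shows "indiv_depth k (Node a ts) \<le> d + e"
  unfolding indiv_depth_le_iff
proof
  fix p assume p: "p \<in> root_leaf_paths (Node a ts)"
  then obtain p' where p': "p = Node a ts # p'"
    "p' = [] \<or> (\<exists>s\<in>set ts. p' \<in> root_leaf_paths s)"
    by (auto split: if_splits)
  have "length (filter (indiv_node k) p') \<le> d"
    using p'(2) assms(1) unfolding indiv_depth_le_iff by auto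
  then show "length (filter (indiv_node k) p) \<le> d + e" using assms(2) p'(1) by auto
qed

text \<open>A bound rather than a minimum, so that all children of a node can be given the same
  \<open>d\<close>.\<close>

definition irc_depth_le :: "nat \<Rightarrow> ('v, 'c) cgraph \<Rightarrow> nat \<Rightarrow> bool" where
  "irc_depth_le k g d \<longleftrightarrow> (\<exists>T. irc_tree k g T \<and> indiv_depth k T \<le> d)"

lemma WLD_le: "irc_depth_le k g d \<Longrightarrow> WLD k g \<le> d"
  unfolding irc_depth_le_def WLD_def by (blast intro: Least_le order_trans)

lemma irc_depth_le_mono: "irc_depth_le k g d \<Longrightarrow> d \<le> e \<Longrightarrow> irc_depth_le k g e"
  unfolding irc_depth_le_def by (meson order_trans)

text \<open>The subtrees are chosen only inside the proof, so the conditions on the root are asked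
  for all \<open>ts\<close> with the labels \<open>gs\<close>; they depend on these labels alone.
  \<open>e\<close> is what the root is charged.\<close>

lemma irc_depth_le_Node:
  assumes "\<forall>g'\<in>set gs. irc_depth_le k g' d"
    and root: "\<And>ts. map label ts = gs \<Longrightarrow> if ts = [] then card (verts (fst g)) = 1
        else D1 k (Node g ts) \<or> D2 (Node g ts) \<or> D3 (Node g ts) \<or> D4 (Node g ts)"
    and indiv: "\<And>ts. map label ts = gs \<Longrightarrow> indiv_node k (Node g ts) \<Longrightarrow> 1 \<le> e"
  shows "irc_depth_le k g (d + e)"
proof -
  obtain T where T: "\<And>g'. g' \<in> set gs \<Longrightarrow> irc_tree k g' (T g') \<and> indiv_depth k (T g') \<le> d"
    using assms(1) unfolding irc_depth_le_def by metis
  define ts where "ts = map T gs"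
  have "map label ts = gs"
    using T unfolding ts_def irc_tree_def by (simp add: map_idI)
  note root = root[OF this] and indiv = indiv[OF this]
  have "irc_tree k g (Node g ts)"
    using root T unfolding irc_tree_def ts_def by auto
  moreover have "indiv_depth k (Node g ts) \<le> d + e"
    using T indiv by (intro indiv_depth_Node) (auto simp: ts_def)
  ultimately show ?thesis unfolding irc_depth_le_def by blast
qed

lemma irc_depth_le_leaf:
  assumes "card (verts (fst g)) = 1"
  shows "irc_depth_le k g 0"
  using irc_depth_le_Node[of "[]" k 0 g 0] assms by (simp add: indiv_node_def D4_def)

text \<open>A node satisfying one of \<open>D1\<close>, \<open>D2\<close>, \<open>D3\<close> does
  not count as an individualization node, even if \<open>D4\<close> holds as well.\<close>

lemma irc_depth_le_free:
  assumes "\<forall>g'\<in>set gs. irc_depth_le k g' d" "gs \<noteq> []"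
    and free: "\<And>ts. map label ts = gs \<Longrightarrow> D1 k (Node g ts) \<or> D2 (Node g ts) \<or> D3 (Node g ts)"
  shows "irc_depth_le k g d"
proof -
  have "irc_depth_le k g (d + 0)"
  proof (rule irc_depth_le_Node[OF assms(1)])
    fix ts assume ts: "map label ts = gs"
    then have "ts \<noteq> []" using assms(2) by blast
    then show "if ts = [] then card (verts (fst g)) = 1
        else D1 k (Node g ts) \<or> D2 (Node g ts) \<or> D3 (Node g ts) \<or> D4 (Node g ts)"
      using free[OF ts] by auto
    assume "indiv_node k (Node g ts)"
    then show "1 \<le> (0 :: nat)" using free[OF ts] unfolding indiv_node_def by blast
  qed
  then show ?thesis by simp
qed

lemma irc_depth_le_WL:
  assumes "irc_depth_le k (G, WL k G \<chi>) d"
  shows "irc_depth_le k (G, \<chi>) d"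
proof (rule irc_depth_le_free[of "[(G, WL k G \<chi>)]"])
  fix ts assume "map label ts = [(G, WL k G \<chi>)]"
  then obtain s where "ts = [s]" "label s = (G, WL k G \<chi>)" by auto
  then have "D1 k (Node (G, \<chi>) ts)" by (simp add: D1_def cg_eq_def)
  then show "D1 k (Node (G, \<chi>) ts) \<or> D2 (Node (G, \<chi>) ts) \<or> D3 (Node (G, \<chi>) ts)" ..
qed (use assms in simp_all)

lemma irc_depth_le_flip:
  assumes "irc_depth_le k (flip f g) d" "flip_function g f"
  shows "irc_depth_le k g d"
proof (rule irc_depth_le_free[of "[flip f g]"])
  fix ts assume "map label ts = [flip f g]"
  then obtain s where "ts = [s]" "label s = flip f g" by auto
  then have "D2 (Node g ts)"
    using assms(2) unfolding D2_def by (auto simp: cg_eq_def split: prod.splits)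
  then show "D1 k (Node g ts) \<or> D2 (Node g ts) \<or> D3 (Node g ts)" by blast
qed (use assms in simp_all)

lemma irc_depth_le_components:
  assumes "simple_graph G" "\<forall>A\<in>components G. irc_depth_le k (induced G A, \<chi>) d"
  shows "irc_depth_le k (G, \<chi>) d"
proof -
  have "finite (components G)" and ne: "components G \<noteq> {}"
    using assms(1) unfolding components_def quotient_def simple_graph_def by simp_all
  then obtain As where As: "set As = components G" "distinct As" using finite_distinct_list by blast
  let ?gs = "map (\<lambda>A. (induced G A, \<chi>)) As"
  show ?thesis
  proof (rule irc_depth_le_free[of ?gs])
    show "\<forall>g'\<in>set ?gs. irc_depth_le k g' d" using assms(2) As(1) by simp
    show "?gs \<noteq> []" using ne As(1) by auto
    fix ts assume "map label ts = ?gs"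
    then have "list_all2 (\<lambda>s A. label s = (induced G A, \<chi>)) ts As"
      by (simp add: list_all2_map1 list_all2_map2 flip: list.rel_eq)
    then have "list_all2 (\<lambda>s A. label s \<cong>\<^sub>c (induced G A, \<chi>)) ts As"
      by (rule list_all2_mono) (simp add: cg_eq_def)
    then have "D3 (Node (G, \<chi>) ts)" using As unfolding D3_def by auto
    then show "D1 k (Node (G, \<chi>) ts) \<or> D2 (Node (G, \<chi>) ts) \<or> D3 (Node (G, \<chi>) ts)" by blast
  qed
qed

lemma irc_depth_le_indiv:
  assumes "irc_depth_le k (G, \<chi>(u := c)) d" "u \<in> verts G" "c \<notin> \<chi> ` verts G"
  shows "irc_depth_le k (G, \<chi>) (d + 1)"
proof (rule irc_depth_le_Node[of "[(G, \<chi>(u := c))]"])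
  fix ts assume ts: "map label ts = [(G, \<chi>(u := c))]"
  then obtain s where s: "ts = [s]" "label s = (G, \<chi>(u := c))" by auto
  then have "D4 (Node (G, \<chi>) ts)"
    using assms(2,3) unfolding D4_def by (auto simp: cg_eq_def intro!: exI[of _ u] exI[of _ c])
  then show "if ts = [] then card (verts (fst (G, \<chi>))) = 1
    else D1 k (Node (G, \<chi>) ts) \<or> D2 (Node (G, \<chi>) ts) \<or> D3 (Node (G, \<chi>) ts) \<or> D4 (Node (G, \<chi>) ts)"
    using s by simp
qed (use assms in auto)

lemma infinite_color: "infinite (UNIV :: 'c color set)"
proof
  assume "finite (UNIV :: 'c color set)"
  moreover have "inj (\<lambda>c :: 'c color. CR c {#})" by (rule injI) simp
  ultimately have "surj (\<lambda>c :: 'c color. CR c {#})" using finite_UNIV_inj_surj by blast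
  then obtain c :: "'c color" where "Base undefined = CR c {#}" by (metis surjD)
  then show False by simp
qed

text \<open>One \<open>D4\<close> node with a fresh color, followed by a free \<open>D1\<close>
  node; refinement keeps \<open>x\<close> alone in its class.\<close>

lemma irc_depth_le_individualizes:
  fixes \<chi> :: "'v \<Rightarrow> 'c color"
  assumes "simple_graph G" "x \<in> verts G"
  obtains c' where "individualizes (verts G) (adj G) x \<chi> c'"
    "\<forall>d. irc_depth_le 1 (G, c') d \<longrightarrow> irc_depth_le 1 (G, \<chi>) (d + 1)"
proof -
  have "finite (\<chi> ` verts G)" using assms(1) unfolding simple_graph_def by blast
  then obtain k where k: "k \<notin> \<chi> ` verts G" using infinite_color ex_new_if_finite by blast
  let ?c = "\<chi>(x := k)"
  have r: "refines (verts G) (WL 1 G ?c) ?c" using refines_WL_1[OF assms(1)] .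
  have new: "\<chi> y \<noteq> k" if "y \<in> verts G" for y using k that by blast
  have "individualizes (verts G) (adj G) x \<chi> (WL 1 G ?c)"
    unfolding individualizes_def
  proof (intro conjI equitable_WL_1[OF assms(1)] ballI impI)
    have "refines (verts G) ?c \<chi>" using new unfolding refines_def by (auto split: if_splits)
    then show "refines (verts G) (WL 1 G ?c) \<chi>" using r refines_trans by blast
    show "y = x" if "y \<in> verts G" "WL 1 G ?c y = WL 1 G ?c x" for y
    proof (rule ccontr)
      assume "y \<noteq> x"
      then have "?c y \<noteq> ?c x" using new[OF that(1)] by simp
      then show False using r that assms(2) unfolding refines_def by blast
    qed
  qed
  then show thesis
    by (rule that) (intro allI impI irc_depth_le_indiv[OF irc_depth_le_WL assms(2) k])
qed

section \<open>Effect of flips, components and smaller covers\<close>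

lemma adj_flip:
  assumes "simple_graph G" "\<And>a b. f a b = f b a"
  shows "adj (fst (flip f (G, \<chi>))) = flip_relation (verts G) (adj G) \<chi> f"
proof (intro ext iffI)
  fix v w
  assume "adj (fst (flip f (G, \<chi>))) v w"
  then obtain v' w' where "{v, w} = {v', w'}" "v' \<in> verts G" "w' \<in> verts G" "v' \<noteq> w'"
    "adj G v' w' \<noteq> f (\<chi> v') (\<chi> w')"
    unfolding adj_def flip_def by auto
  moreover have "flip_relation (verts G) (adj G) \<chi> f v w" if "flip_relation (verts G) (adj G) \<chi> f w v"
    using that assms(2)[of "\<chi> v" "\<chi> w"] adj_sym[of G v w] adj_sym[of G w v]
    unfolding flip_relation_def by auto
  ultimately show "flip_relation (verts G) (adj G) \<chi> f v w"
    unfolding flip_relation_def doubleton_eq_iff by blast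
next
  fix v w
  assume "flip_relation (verts G) (adj G) \<chi> f v w"
  then show "adj (fst (flip f (G, \<chi>))) v w"
    unfolding flip_relation_def flip_def by (subst adj_def) auto
qed

lemma simple_graph_flip: "simple_graph G \<Longrightarrow> simple_graph (fst (flip f (G, \<chi>)))"
  unfolding simple_graph_def flip_def by auto

lemma verts_flip [simp]: "verts (fst (flip f (G, \<chi>))) = verts G"
  by (simp add: flip_def)

lemma adj_induced: "adj (induced G A) v w \<longleftrightarrow> adj G v w \<and> v \<in> A \<and> w \<in> A"
  by (auto simp: adj_def induced_def)

lemma verts_induced [simp]: "verts (induced G A) = A"
  by (simp add: induced_def)

lemma component_closed:
  assumes "simple_graph G" "A \<in> components G"
  shows "A \<subseteq> verts G" "A \<noteq> {}" "\<And>v w. v \<in> A \<Longrightarrow> adj G v w \<Longrightarrow> w \<in> A"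
    "\<And>v w. v \<in> A \<Longrightarrow> w \<in> A \<Longrightarrow> (adj G)\<^sup>*\<^sup>* v w"
proof -
  have sym: "(adj G)\<^sup>*\<^sup>* b a" if "(adj G)\<^sup>*\<^sup>* a b" for a b
    using that by (induction rule: rtranclp_induct) (auto intro: adj_sym converse_rtranclp_into_rtranclp)
  obtain a where a: "a \<in> verts G" "A = {w \<in> verts G. (adj G)\<^sup>*\<^sup>* a w}"
    using assms(2) unfolding components_def quotient_def by auto
  show "A \<subseteq> verts G" "A \<noteq> {}" using a by auto
  show "w \<in> A" if "v \<in> A" "adj G v w" for v w
    using that a adj_verts[OF assms(1) that(2)] rtranclp.rtrancl_into_rtrancl by fastforce
  show "(adj G)\<^sup>*\<^sup>* v w" if "v \<in> A" "w \<in> A" for v w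
    using that a sym[of a v] rtranclp_trans[of "adj G" v a w] by blast
qed

lemma component_proper:
  assumes "simple_graph G" "A \<in> components G" "Z \<subseteq> verts G" "Z \<noteq> {}" "Z \<noteq> verts G"
    and closed: "\<And>p q. p \<in> Z \<Longrightarrow> q \<in> verts G - Z \<Longrightarrow> \<not> adj G p q"
  shows "A \<noteq> verts G"
proof
  assume A: "A = verts G"
  obtain z y where zy: "z \<in> Z" "y \<in> verts G" "y \<notin> Z" using assms(3-5) by blast
  have "(adj G)\<^sup>*\<^sup>* z y" using component_closed(4)[OF assms(1,2)] A zy assms(3) by blast
  then have "y \<in> Z"
    by (induction rule: rtranclp_induct) (use zy closed adj_verts[OF assms(1)] in blast)+
  then show False using zy by blast
qed

text \<open>The colors lost in passing to \<open>A\<close> are at most as many as the vertices of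
  \<open>S\<close> lost, and purity is inherited.\<close>

lemma potential_subset:
  assumes "finite S" "A \<subseteq> V"
  shows "potential A (S \<inter> A) c \<le> potential V S c"
proof -
  have "c ` S \<subseteq> c ` (S \<inter> A) \<union> c ` (S - A)" by blast
  then have "card (c ` S) \<le> card (c ` (S \<inter> A) \<union> c ` (S - A))"
    using assms(1) by (intro card_mono) auto
  also have "\<dots> \<le> card (c ` (S \<inter> A)) + card (c ` (S - A))" by (rule card_Un_le)
  also have "card (c ` (S - A)) \<le> card (S - A)" using assms(1) by (intro card_image_le) simp
  finally have "card (c ` S) \<le> card (c ` (S \<inter> A)) + card (S - A)" by simp
  moreover have "card S = card (S \<inter> A) + card (S - A)" using assms(1) by (rule card_Int_Diff)
  moreover have "pure V S c \<Longrightarrow> pure A (S \<inter> A) c" using assms(2) unfolding pure_def by blast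
  ultimately show ?thesis unfolding potential_def by auto
qed

text \<open>One vertex and at most one color disappear. The summand 3 is already present, so the new
  coloring status cannot add it; for a pure coloring the removal could, hence covers are shrunk only
  in the impure case.\<close>

lemma potential_remove:
  assumes "finite S" "v \<in> S" "\<not> pure V S c"
  shows "potential V (S - {v}) c \<le> potential V S c"
proof -
  have "c ` S \<subseteq> insert (c v) (c ` (S - {v}))" by auto
  then have "card (c ` S) \<le> card (insert (c v) (c ` (S - {v})))"
    using assms(1) by (intro card_mono) auto
  also have "\<dots> \<le> Suc (card (c ` (S - {v})))" using assms(1) by (simp add: card_insert_if)
  finally have "card (c ` S) \<le> Suc (card (c ` (S - {v})))" .
  moreover have "card S = Suc (card (S - {v}))" using card_Suc_Diff1[OF assms(1,2)] by simp
  ultimately show ?thesis using assms(3) unfolding potential_def by (simp, arith)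
qed

text \<open>The induction measure has one summand for each kind of step: vertices for components,
  arcs for flips, \<open>card S\<close> for shrinking the cover, and the potential for
  individualizations. In each step the other three do not grow.\<close>

lemma irc_depth_le_potential:
  fixes G :: "'v graph" and \<chi> :: "'v \<Rightarrow> 'c color"
  assumes "simple_graph G" "vertex_cover G S" "equitable (verts G) (adj G) \<chi>"
  shows "irc_depth_le 1 (G, \<chi>) (potential (verts G) S \<chi> div 3)"
  using assms
proof (induction "card (verts G) + card (arcs (verts G) (adj G)) + card S + potential (verts G) S \<chi>"
    arbitrary: G S \<chi> rule: less_induct)
  case less
  note G = \<open>simple_graph G\<close> and S = \<open>vertex_cover G S\<close> and eq = \<open>equitable (verts G) (adj G) \<chi>\<close>
  define V where "V = verts G"
  define E where "E = adj G"
  note VE = V_def[symmetric] E_def[symmetric]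
  note G' = adj_verts[OF G, unfolded VE] adj_sym[of G, unfolded VE] adj_irrefl[OF G, unfolded VE]
    vertex_cover_adj[OF S, unfolded VE] eq[unfolded VE]
  have fin: "finite V" "V \<noteq> {}" "S \<subseteq> V"
    using G S unfolding simple_graph_def vertex_cover_def V_def by blast+
  have finS: "finite S" using fin finite_subset by blast
  have degree: "card {z \<in> V. E x z \<and> \<chi> z = k} = card {z \<in> V. E y z \<and> \<chi> z = k}"
    if "x \<in> V" "y \<in> V" "\<chi> x = \<chi> y" for x y k
    using G'(5) that unfolding equitable_def by blast
  have flip_pair: "irc_depth_le 1 (G, \<chi>) (potential V S \<chi> div 3)"
    if cover: "\<And>v w. flip_relation V E \<chi> (pair_flip p q) v w \<Longrightarrow> v \<in> S \<or> w \<in> S"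
      and arcs: "card (arcs V (flip_relation V E \<chi> (pair_flip p q))) < card (arcs V E)" for p q
  proof (rule irc_depth_le_flip)
    let ?H = "fst (flip (pair_flip p q) (G, \<chi>))"
    have H: "flip (pair_flip p q) (G, \<chi>) = (?H, \<chi>)" by (simp add: flip_def)
    have sym: "pair_flip p q a b = pair_flip p q b a" for a b :: "'c color"
      by (auto simp: pair_flip_def)
    show "flip_function (G, \<chi>) (pair_flip p q)" unfolding flip_function_def using sym by auto
    have adj: "adj ?H = flip_relation V E \<chi> (pair_flip p q)"
      using adj_flip[OF G sym] unfolding VE .
    have "irc_depth_le 1 (?H, \<chi>) (potential (verts ?H) S \<chi> div 3)"
    proof (rule less.hyps)
      show sg: "simple_graph ?H" by (rule simple_graph_flip[OF G])
      show "vertex_cover ?H S"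
        by (rule vertex_coverI[OF sg]) (use fin cover adj VE in auto)
      show "equitable (verts ?H) (adj ?H) \<chi>"
        unfolding adj verts_flip VE by (rule equitable_flip[OF fin(1) G'(5,3)])
      show "card (verts ?H) + card (arcs (verts ?H) (adj ?H)) + card S + potential (verts ?H) S \<chi>
        < card (verts G) + card (arcs (verts G) (adj G)) + card S + potential (verts G) S \<chi>"
        unfolding adj verts_flip VE using arcs by simp
    qed
    then show "irc_depth_le 1 (flip (pair_flip p q) (G, \<chi>)) (potential V S \<chi> div 3)"
      unfolding verts_flip VE by (subst H)
  qed
  show ?case unfolding VE
  proof (cases "card V = 1")
    case True
    then show "irc_depth_le 1 (G, \<chi>) (potential V S \<chi> div 3)"
      using irc_depth_le_leaf[of "(G, \<chi>)" 1] irc_depth_le_mono unfolding V_def by fastforce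
  next
    case card1: False
    show "irc_depth_le 1 (G, \<chi>) (potential V S \<chi> div 3)"
    proof (rule ccontr)
      \<comment> \<open>Any free step that makes progress would give the bound by induction. Its
        assumed failure therefore yields the assumptions of \<open>reduced_coloring\<close> one
        after another.\<close>
      assume neg: "\<not> ?thesis"
      have conn: "\<exists>p\<in>Z. \<exists>q\<in>V - Z. E p q" if Z: "Z \<subseteq> V" "Z \<noteq> {}" "Z \<noteq> V" for Z
      proof (rule ccontr)
        assume c: "\<not> ?thesis"
        have "irc_depth_le 1 (induced G A, \<chi>) (potential V S \<chi> div 3)" if A: "A \<in> components G" for A
        proof -
          note AV = component_closed[OF G A, unfolded VE]
          have "A \<noteq> V"
            using component_proper[OF G A, unfolded VE, OF Z] c by blast
          then have "A \<subset> V" using AV by blast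
          then have cA: "card A < card V" using fin by (intro psubset_card_mono)
          have pot: "potential A (S \<inter> A) \<chi> \<le> potential V S \<chi>"
            using potential_subset finS AV(1) by blast
          have adjA: "adj (induced G A) v w \<longleftrightarrow> E v w \<and> v \<in> A \<and> w \<in> A" for v w
            unfolding adj_induced VE ..
          have "irc_depth_le 1 (induced G A, \<chi>) (potential (verts (induced G A)) (S \<inter> A) \<chi> div 3)"
          proof (rule less.hyps)
            have "card (arcs A (adj (induced G A))) \<le> card (arcs V E)"
              by (intro card_mono finite_arcs fin(1)) (use AV(1) adjA in \<open>auto simp: arcs_def\<close>)
            moreover have "card (S \<inter> A) \<le> card S" using finS by (intro card_mono) auto
            ultimately show "card (verts (induced G A)) + card (arcs (verts (induced G A)) (adj (induced G A)))
                + card (S \<inter> A) + potential (verts (induced G A)) (S \<inter> A) \<chi>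
              < card (verts G) + card (arcs (verts G) (adj G)) + card S + potential (verts G) S \<chi>"
              using cA pot unfolding verts_induced VE by linarith
            show sg: "simple_graph (induced G A)"
              using G AV finite_subset[OF AV(1) fin(1)] unfolding simple_graph_def induced_def by auto
            show "vertex_cover (induced G A) (S \<inter> A)"
              by (rule vertex_coverI[OF sg]) (use adjA G'(4) in auto)
            have N: "{z \<in> A. adj (induced G A) x z \<and> \<chi> z = k} = {z \<in> V. E x z \<and> \<chi> z = k}"
              if "x \<in> A" for x k using that adjA AV by blast
            show "equitable (verts (induced G A)) (adj (induced G A)) \<chi>"
              unfolding equitable_def verts_induced
            proof (intro ballI impI allI)
              fix x y k assume "x \<in> A" "y \<in> A" "\<chi> x = \<chi> y"
              then show "card {z \<in> A. adj (induced G A) x z \<and> \<chi> z = k} =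
                  card {z \<in> A. adj (induced G A) y z \<and> \<chi> z = k}"
                using degree[of x y k] AV(1) N by (simp add: subset_iff)
            qed
          qed
          then show ?thesis using pot irc_depth_le_mono by (fastforce intro: div_le_mono)
        qed
        then show False using neg irc_depth_le_components[OF G] by blast
      qed
      have min: "\<not> pure V S \<chi> \<longrightarrow> (\<forall>v\<in>S. \<exists>y. E v y \<and> y \<notin> S)"
      proof (rule ccontr)
        assume "\<not> ?thesis"
        then have np: "\<not> pure V S \<chi>" and "\<not> (\<forall>v\<in>S. \<exists>y. E v y \<and> y \<notin> S)" by blast+
        \<comment> \<open>All neighbours of \<open>v\<close> are in \<open>S\<close>, so the cover
          can do without \<open>v\<close>.\<close>
        then obtain v where v: "v \<in> S" "\<And>y. E v y \<Longrightarrow> y \<in> S" by blast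
        have pot: "potential V (S - {v}) \<chi> \<le> potential V S \<chi>"
          using potential_remove[OF finS v(1) np] .
        have "card (S - {v}) < card S" using finS v(1) by (rule card_Diff1_less)
        then have "irc_depth_le 1 (G, \<chi>) (potential (verts G) (S - {v}) \<chi> div 3)"
        proof (intro less.hyps G eq)
          show "vertex_cover G (S - {v})"
          proof (rule vertex_coverI[OF G])
            fix a b assume "adj G a b"
            then have "E a b" "E b a" "a \<noteq> b" using G' VE adj_sym adj_irrefl[OF G] by metis+
            then show "a \<in> S - {v} \<or> b \<in> S - {v}" using v G'(4)[of a b] by blast
          qed (use fin V_def in blast)
        qed (use pot VE in simp)
        then show False
          using neg pot irc_depth_le_mono[OF _ div_le_mono] unfolding VE by blast
      qed
      have full: "\<exists>z\<in>V. \<chi> z = \<chi> y \<and> z \<noteq> x \<and> \<not> E x z" if xy: "E x y" "\<chi> x = \<chi> y" for x y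
      proof (rule ccontr)
        assume n: "\<not> ?thesis"
        define M where "M = {z \<in> V. \<chi> z = \<chi> y}"
        have xyV: "x \<in> V" "y \<in> V" using G'(1)[OF xy(1)] by blast+
        have finM: "finite M" using fin by (simp add: M_def)
        have all: "E u v" if uv: "u \<in> V" "v \<in> V" "\<chi> u = \<chi> y" "\<chi> v = \<chi> y" "u \<noteq> v" for u v
        proof -
          have "{z \<in> V. E x z \<and> \<chi> z = \<chi> y} = M - {x}"
            using n G'(3) unfolding M_def by blast
          moreover have "card {z \<in> V. E u z \<and> \<chi> z = \<chi> y} = card {z \<in> V. E x z \<and> \<chi> z = \<chi> y}"
            by (rule degree) (use uv xyV xy(2) in simp_all)
          moreover have "x \<in> M" "u \<in> M" using uv xy xyV by (simp_all add: M_def)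
          ultimately have "card {z \<in> V. E u z \<and> \<chi> z = \<chi> y} = card (M - {u})"
            using finM by simp
          moreover have "{z \<in> V. E u z \<and> \<chi> z = \<chi> y} \<subseteq> M - {u}"
            using G'(3) unfolding M_def by blast
          ultimately have "{z \<in> V. E u z \<and> \<chi> z = \<chi> y} = M - {u}"
            using finM by (intro card_subset_eq) auto
          then show ?thesis using uv by (auto simp: M_def)
        qed
        have "irc_depth_le 1 (G, \<chi>) (potential V S \<chi> div 3)"
        proof (rule flip_pair)
          show "card (arcs V (flip_relation V E \<chi> (pair_flip (\<chi> y) (\<chi> y)))) < card (arcs V E)"
            by (rule arcs_flip_full[where x = x and y = y]) (fact fin(1) xyV xy refl all)+
          show "v \<in> S \<or> w \<in> S" if "flip_relation V E \<chi> (pair_flip (\<chi> y) (\<chi> y)) v w" for v w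
          proof -
            have "E v w"
              using that all[of v w] by (auto simp: flip_relation_def pair_flip_def)
            then show ?thesis by (rule G'(4))
          qed
        qed
        then show False using neg by blast
      qed
      have dense: "2 * card {z \<in> V. E x z \<and> \<chi> z = \<chi> y} \<le> card {z \<in> V. \<chi> z = \<chi> y}"
        if xy: "E x y" "\<chi> x \<noteq> \<chi> y" and yS: "\<forall>z\<in>V. \<chi> z = \<chi> y \<longrightarrow> z \<in> S" for x y
      proof (rule ccontr)
        assume n: "\<not> ?thesis"
        have xV: "x \<in> V" using G'(1)[OF xy(1)] by blast
        have "irc_depth_le 1 (G, \<chi>) (potential V S \<chi> div 3)"
        proof (rule flip_pair)
          show "card (arcs V (flip_relation V E \<chi> (pair_flip (\<chi> x) (\<chi> y)))) < card (arcs V E)"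
          proof (rule arcs_flip_dense[where x = x])
            fix v assume "v \<in> V" "\<chi> v = \<chi> x"
            then have "card {w \<in> V. E v w \<and> \<chi> w = \<chi> y} = card {w \<in> V. E x w \<and> \<chi> w = \<chi> y}"
              using degree xV by blast
            then show "card {w \<in> V. \<chi> w = \<chi> y} < 2 * card {w \<in> V. E v w \<and> \<chi> w = \<chi> y}"
              using n by simp
          qed (fact fin(1) G'(2) xy(2) xV refl)+
          \<comment> \<open>A pair made adjacent by the flip has an end in the class of
            \<open>y\<close>, which lies in \<open>S\<close>.\<close>
          show "v \<in> S \<or> w \<in> S" if "flip_relation V E \<chi> (pair_flip (\<chi> x) (\<chi> y)) v w" for v w
          proof (cases "E v w")
            case False
            then show ?thesis
              using that yS by (auto simp: flip_relation_def pair_flip_def)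
          qed (rule G'(4))
        qed
        then show False using neg by blast
      qed
      have two: "\<exists>x\<in>V. \<exists>y\<in>V. x \<noteq> y"
      proof (rule ccontr)
        assume "\<not> ?thesis"
        then obtain x where "V = {x}" using fin(2) by blast
        then show False using card1 by simp
      qed
      interpret reduced_coloring V E \<chi> S
        by unfold_locales (fact fin G' conn full dense two)+
      have drop: "irc_depth_le 1 (G, c') (potential V S c' div 3)"
        if "equitable V E c'" "potential V S c' < potential V S \<chi>" for c' :: "'v \<Rightarrow> 'c color"
        using less.hyps[OF _ G S, of c'] that unfolding VE by simp
      have "irc_depth_le 1 (G, \<chi>) (potential V S \<chi> div 3)"
        using potential_step[OF min]
      proof (elim disjE bexE)
        fix x
        assume x: "x \<in> V" and d: "\<forall>c'. individualizes V E x \<chi> c' \<longrightarrow>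
          potential V S c' + 3 \<le> potential V S \<chi>"
        obtain c' where i: "individualizes V E x \<chi> c'"
          and up: "\<forall>d. irc_depth_le 1 (G, c') d \<longrightarrow> irc_depth_le 1 (G, \<chi>) (d + 1)"
          by (rule irc_depth_le_individualizes[where \<chi> = \<chi>, OF G, unfolded VE, OF x])
        have p: "potential V S c' + 3 \<le> potential V S \<chi>" using d i by blast
        have "irc_depth_le 1 (G, c') (potential V S c' div 3)"
          by (rule drop) (use i p in \<open>simp_all add: individualizes_def\<close>)
        from up[rule_format, OF this] show ?thesis by (rule irc_depth_le_mono) (use p in linarith)
      next
        fix x y
        assume xy: "x \<in> V" "y \<in> V" and d: "\<forall>c' c''. individualizes V E x \<chi> c' \<longrightarrow>
          individualizes V E y c' c'' \<longrightarrow> potential V S c'' + 6 \<le> potential V S \<chi>"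
        obtain c' where i: "individualizes V E x \<chi> c'"
          and up: "\<forall>d. irc_depth_le 1 (G, c') d \<longrightarrow> irc_depth_le 1 (G, \<chi>) (d + 1)"
          by (rule irc_depth_le_individualizes[where \<chi> = \<chi>, OF G, unfolded VE, OF xy(1)])
        obtain c'' where i': "individualizes V E y c' c''"
          and up': "\<forall>d. irc_depth_le 1 (G, c'') d \<longrightarrow> irc_depth_le 1 (G, c') (d + 1)"
          by (rule irc_depth_le_individualizes[where \<chi> = c', OF G, unfolded VE, OF xy(2)])
        have p: "potential V S c'' + 6 \<le> potential V S \<chi>" using d i i' by blast
        \<comment> \<open>The intermediate coloring \<open>c'\<close> may have gained less than 3.
          The induction hypothesis is applied to \<open>c''\<close> only, where both
          individualizations are paid for.\<close>
        have "irc_depth_le 1 (G, c'') (potential V S c'' div 3)"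
          by (rule drop) (use i' p in \<open>simp_all add: individualizes_def\<close>)
        from up[rule_format, OF up'[rule_format, OF this]] show ?thesis by (rule irc_depth_le_mono) (use p in linarith)
      qed
      then show False using neg by blast
    qed
  qed
qed

theorem theorem21:
  fixes G :: "'v graph" and \<chi> :: "'v \<Rightarrow> 'c color" and r :: nat
  assumes "simple_graph G"
    and "vertex_cover_number G = r"
  shows "real (WLD 1 (G, \<chi>)) \<le> 2 / 3 * real r + 1"
proof -
  have "vertex_cover G (verts G)"
    by (rule vertex_coverI[OF assms(1)]) (use adj_verts[OF assms(1)] in auto)
  then have "\<exists>n S. vertex_cover G S \<and> card S = n" by blast
  from LeastI_ex[OF this] obtain S where S: "vertex_cover G S" "card S = r"
    using assms(2) unfolding vertex_cover_number_def by blast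
  let ?p = "potential (verts G) S (WL 1 G \<chi>)"
  \<comment> \<open>The given coloring is arbitrary; one free refinement makes it equitable.\<close>
  have "irc_depth_le 1 (G, \<chi>) (?p div 3)"
    by (rule irc_depth_le_WL[OF irc_depth_le_potential[OF assms(1) S(1) equitable_WL_1[OF assms(1)]]])
  then have "WLD 1 (G, \<chi>) \<le> ?p div 3" by (rule WLD_le)
  \<comment> \<open>The 3 for a coloring that is not pure becomes the additive 1 after division by
    3.\<close>
  moreover have "?p \<le> 2 * r + 3" unfolding potential_def using S(2) by (auto split: if_splits)
  ultimately have "3 * WLD 1 (G, \<chi>) \<le> 2 * r + 3" by linarith
  then show ?thesis by linarith
qed

end
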